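(* The following are equivalent for $A,B\in 2^\omega$: (i) $A\leq_{\mathit{CR}}B$, i.e., $\mathrm{CR}^B\subseteq\mathrm{CR}^A$. (ii) Every $A$-winning open set can be covered by a $B$-winning open set (i.e., is contained in some $B$-winning open set).
   Context: $2^\omega$ is Cantor space, $2^{<\omega}$ the set of finite binary strings, $\epsilon$ the empty string. For $U\subseteq 2^{<\omega}$, $[U]$ is the set of infinite sequences having a prefix in $U$. A martingale is a function $d:2^{<\omega}\to\mathbb{R}^{\geq 0}$ with $d(\sigma)=\frac{d(\sigma 0)+d(\sigma 1)}{2}$ for all $\sigma$; it is normed if $d(\epsilon)=1$; it succeeds on $X$ if $\limsup_n d(X\upharpoonright n)=+\infty$. For an oracle $Z$, $\mathrm{CR}^Z$ is the set of sequences on which no $Z$-computable (real-valued) martingale succeeds. A martingale is exactly $Z$-computable if it is rational-valued and $Z$-computable as a function into $\mathbb{Q}^{\geq 0}$. A string is minimal for a property if it satisfies the property and no proper prefix of it does. A $Z$-winning open set is a set $[U]$ where $U=\{\sigma:\sigma\text{ minimal such that }d(\sigma)\geq q\}$ for some exactly $Z$-computable normed martingale $d$ and rational $q>1$. *)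

theory Defs
  imports Complex_Main "HOL-Library.Sublist" "HOL-Library.Extended_Real"
begin

section \<open>Computability relative to an element of Cantor space\<close>

text \<open>Cantor space is the type \<open>nat \<Rightarrow> bool\<close>, and finite binary strings are \<open>bool list\<close>.
  Relative computability is given by the usual partial recursive functions on tuples of
  natural numbers, with an additional basic function answering membership queries to the
  oracle. \<open>None\<close> means divergence; all operations are strict.\<close>

datatype prog =
    Zero
  | Succ
  | Proj nat
  | Query
  | Comp prog "prog list"
  | Prec prog prog
  | Mini prog

fun run :: "(nat \<Rightarrow> bool) \<Rightarrow> prog \<Rightarrow> nat list \<Rightarrow> nat option" where
  "run Z Zero xs = Some 0"
| "run Z Succ xs = (case xs of [] \<Rightarrow> None | x # _ \<Rightarrow> Some (Suc x))"
| "run Z (Proj i) xs = (if i < length xs then Some (xs ! i) else None)"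
| "run Z Query xs = (case xs of [] \<Rightarrow> None | x # _ \<Rightarrow> Some (of_bool (Z x)))"
| "run Z (Comp f gs) xs = Option.bind (those (map (\<lambda>g. run Z g xs) gs)) (run Z f)"
| "run Z (Prec f g) xs = (case xs of [] \<Rightarrow> None | x # ys \<Rightarrow>
     rec_nat (run Z f ys) (\<lambda>n r. Option.bind r (\<lambda>v. run Z g (n # v # ys))) x)"
| "run Z (Mini f) xs =
     (if \<exists>n. run Z f (n # xs) = Some 0 \<and> (\<forall>m<n. \<exists>v. run Z f (m # xs) = Some (Suc v))
      then Some (LEAST n. run Z f (n # xs) = Some 0) else None)"

definition computable_nat :: "(nat \<Rightarrow> bool) \<Rightarrow> nat \<Rightarrow> (nat list \<Rightarrow> nat) \<Rightarrow> bool" where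
  "computable_nat Z k F \<longleftrightarrow> (\<exists>p. \<forall>xs. length xs = k \<longrightarrow> run Z p xs = Some (F xs))"

text \<open>A rational-valued function is computable if its sign, numerator and denominator can be
  chosen computable (the fraction need not be reduced).\<close>

definition computable_rat :: "(nat \<Rightarrow> bool) \<Rightarrow> nat \<Rightarrow> (nat list \<Rightarrow> rat) \<Rightarrow> bool" where
  "computable_rat Z k f \<longleftrightarrow> (\<exists>s a b.
     computable_nat Z k s \<and> computable_nat Z k a \<and> computable_nat Z k b \<and>
     (\<forall>xs. length xs = k \<longrightarrow>
        b xs \<noteq> 0 \<and> f xs = (-1) ^ s xs * of_nat (a xs) / of_nat (b xs)))"

text \<open>The string \<open>\<sigma>\<close> is coded by the number with binary expansion \<open>1\<sigma>\<close>, a bijection between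
  strings and positive integers (the length-lexicographic position of \<open>\<sigma>\<close>).\<close>

definition string_code :: "bool list \<Rightarrow> nat" where
  "string_code \<sigma> = foldl (\<lambda>n b. 2 * n + of_bool b) 1 \<sigma>"

definition exactly_computable :: "(nat \<Rightarrow> bool) \<Rightarrow> (bool list \<Rightarrow> real) \<Rightarrow> bool" where
  "exactly_computable Z d \<longleftrightarrow>
     (\<exists>f. computable_rat Z 1 f \<and> (\<forall>\<sigma>. d \<sigma> = of_rat (f [string_code \<sigma>])))"

definition computable_real :: "(nat \<Rightarrow> bool) \<Rightarrow> (bool list \<Rightarrow> real) \<Rightarrow> bool" where
  "computable_real Z d \<longleftrightarrow>
     (\<exists>f. computable_rat Z 2 f \<and>
        (\<forall>\<sigma> n. \<bar>d \<sigma> - of_rat (f [string_code \<sigma>, n])\<bar> \<le> (1 / 2) ^ n))"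

section \<open>Martingales and computable randomness\<close>

definition initial :: "(nat \<Rightarrow> bool) \<Rightarrow> nat \<Rightarrow> bool list" where
  "initial X n = map X [0..<n]"

definition martingale :: "(bool list \<Rightarrow> real) \<Rightarrow> bool" where
  "martingale d \<longleftrightarrow>
     (\<forall>\<sigma>. 0 \<le> d \<sigma>) \<and> (\<forall>\<sigma>. d \<sigma> = (d (\<sigma> @ [False]) + d (\<sigma> @ [True])) / 2)"

definition normed :: "(bool list \<Rightarrow> real) \<Rightarrow> bool" where
  "normed d \<longleftrightarrow> d [] = 1"

definition succeeds_on :: "(bool list \<Rightarrow> real) \<Rightarrow> (nat \<Rightarrow> bool) \<Rightarrow> bool" where
  "succeeds_on d X \<longleftrightarrow> limsup (\<lambda>n. ereal (d (initial X n))) = \<infinity>"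

definition CR :: "(nat \<Rightarrow> bool) \<Rightarrow> (nat \<Rightarrow> bool) set" where
  "CR Z = {X. \<not> (\<exists>d. martingale d \<and> computable_real Z d \<and> succeeds_on d X)}"

definition CR_le :: "(nat \<Rightarrow> bool) \<Rightarrow> (nat \<Rightarrow> bool) \<Rightarrow> bool" where
  "CR_le A B \<longleftrightarrow> CR B \<subseteq> CR A"

section \<open>Winning open sets\<close>

definition cylinder :: "bool list set \<Rightarrow> (nat \<Rightarrow> bool) set" where
  "cylinder U = {X. \<exists>n. initial X n \<in> U}"

definition minimal_such :: "(bool list \<Rightarrow> bool) \<Rightarrow> bool list \<Rightarrow> bool" where
  "minimal_such P \<sigma> \<longleftrightarrow> P \<sigma> \<and> (\<forall>\<tau>. strict_prefix \<tau> \<sigma> \<longrightarrow> \<not> P \<tau>)"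

definition winning_open :: "(nat \<Rightarrow> bool) \<Rightarrow> (nat \<Rightarrow> bool) set \<Rightarrow> bool" where
  "winning_open Z V \<longleftrightarrow> (\<exists>d (q :: rat).
     martingale d \<and> normed d \<and> exactly_computable Z d \<and> q > 1 \<and>
     V = cylinder {\<sigma>. minimal_such (\<lambda>\<tau>. d \<tau> \<ge> of_rat q) \<sigma>})"

end

theory Submission
  imports Defs "HOL-Library.Countable_Set"
begin

text \<open>
  Both implications rest on one construction. For a normed martingale \<open>e\<close> and a threshold
  \<open>q > 1\<close>, let \<open>restart e q\<close> bet like \<open>e\<close> until \<open>e\<close> has reached \<open>q\<close>, then forget
  the past and bet like \<open>e\<close> from the beginning, and so on. If \<open>X\<close> is an infinite
  concatenation of minimal strings with \<open>e \<sigma> \<ge> q\<close>, the capital is multiplied by at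
  least \<open>q\<close> in each of infinitely many blocks, so \<open>restart e q\<close> succeeds on \<open>X\<close>
  (\<open>succeeds_on_restart\<close>).

  Suppose first that winning sets can be covered, and let an \<open>A\<close>-computable martingale succeed
  on \<open>X\<close>. A cover by a single \<open>B\<close>-winning set must be usable again and again along
  \<open>X\<close>. To this end, a weighted mixture of the shifts of the martingale by all finite strings
  is formed (\<open>tail_mixture\<close>); it is unbounded along every tail of \<open>X\<close>, so all tails lie
  in one \<open>A\<close>-winning set. If \<open>e\<close> and \<open>r\<close> define a \<open>B\<close>-winning set that
  covers it, all tails of \<open>X\<close> lie in the latter, hence \<open>X\<close> can be cut into minimal
  strings with \<open>e \<sigma> \<ge> r\<close>, and \<open>restart e r\<close> shows that \<open>X\<close> is not in
  \<open>CR B\<close>.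

  Conversely, suppose that the \<open>A\<close>-winning set of \<open>d\<close> and \<open>q\<close> has no \<open>B\<close>-winning
  cover. Let \<open>e\<^sub>0, e\<^sub>1, \<dots>\<close> list all exactly \<open>B\<close>-computable martingales. A sequence
  \<open>X = \<sigma>\<^sub>0 \<sigma>\<^sub>1 \<dots>\<close> is built from minimal strings with \<open>d \<sigma> \<ge> q\<close>, while a finite
  positive combination of more and more of the \<open>e\<^sub>k\<close> is kept below 2 along \<open>X\<close>. Given the
  part \<open>\<rho>\<close> already built, a sufficiently small multiple of the next \<open>e\<^sub>k\<close> is added to the
  combination \<open>m\<close> without reaching 2 at \<open>\<rho>\<close>. As the martingale \<open>m (\<rho> \<tau>) / m \<rho>\<close> does
  not yield a cover for any threshold, some minimal string can be appended along which \<open>m\<close> stays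
  below 2 (\<open>uncovered_winning_string\<close>). Then \<open>restart d q\<close> succeeds on \<open>X\<close>, but no
  \<open>e\<^sub>k\<close> does.

  Since \<open>CR\<close> is defined by real-valued martingales and winning sets by rational-valued ones,
  both directions also use that each computable martingale lies below an exactly computable one
  (\<open>exactly_computable_dominating_martingale\<close>). The constructions are exactly computable
  because they use only recursion on the length of a string and bounded sums and products of
  rational values.
\<close>

section \<open>Closure properties of relative computability\<close>

lemma computable_nat_cong:
  assumes "\<And>xs. length xs = k \<Longrightarrow> F xs = G xs"
  shows "computable_nat Z k F \<longleftrightarrow> computable_nat Z k G"
  using assms by (auto simp: computable_nat_def)

lemma those_map_Some: "those (map (\<lambda>x. Some (f x)) xs) = Some (map f xs)"
  by (induction xs) auto

lemma computable_nat_compose: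
  assumes "computable_nat Z (length Gs) F" and "\<And>G. G \<in> set Gs \<Longrightarrow> computable_nat Z k G"
  shows "computable_nat Z k (\<lambda>xs. F (map (\<lambda>G. G xs) Gs))"
proof -
  obtain p where p: "\<And>xs. length xs = length Gs \<Longrightarrow> run Z p xs = Some (F xs)"
    using assms(1) by (auto simp: computable_nat_def)
  obtain r where r: "\<And>G xs. G \<in> set Gs \<Longrightarrow> length xs = k \<Longrightarrow> run Z (r G) xs = Some (G xs)"
    using assms(2) unfolding computable_nat_def by metis
  have "run Z (Comp p (map r Gs)) xs = Some (F (map (\<lambda>G. G xs) Gs))" if "length xs = k" for xs
  proof -
    have "map (\<lambda>g. run Z g xs) (map r Gs) = map (\<lambda>G. Some (G xs)) Gs"
      using r that by simp
    then show ?thesis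
      using p[of "map (\<lambda>G. G xs) Gs"] by (simp add: those_map_Some[of "\<lambda>G. G xs"] del: map_map)
  qed
  then show ?thesis unfolding computable_nat_def by blast
qed

lemma computable_nat_compose1:
  assumes "computable_nat Z 1 (\<lambda>xs. f (xs ! 0))" and "computable_nat Z k F"
  shows "computable_nat Z k (\<lambda>xs. f (F xs))"
  using computable_nat_compose[of Z "[F]" "\<lambda>xs. f (xs ! 0)" k] assms by simp

lemma computable_nat_compose2:
  assumes "computable_nat Z 2 (\<lambda>xs. f (xs ! 0) (xs ! 1))"
    and "computable_nat Z k F" and "computable_nat Z k G"
  shows "computable_nat Z k (\<lambda>xs. f (F xs) (G xs))"
  using computable_nat_compose[of Z "[F, G]" "\<lambda>xs. f (xs ! 0) (xs ! 1)" k] assms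
  by (auto simp: numeral_2_eq_2)

named_theorems computable

lemma computable_nat_nth [computable]: "i < k \<Longrightarrow> computable_nat Z k (\<lambda>xs. xs ! i)"
  unfolding computable_nat_def by (rule exI[of _ "Proj i"]) auto

lemma computable_nat_Suc [computable]:
  assumes "computable_nat Z k F"
  shows "computable_nat Z k (\<lambda>xs. Suc (F xs))"
proof (rule computable_nat_compose1[OF _ assms])
  show "computable_nat Z 1 (\<lambda>xs. Suc (xs ! 0))"
    unfolding computable_nat_def
    by (rule exI[of _ Succ]) (auto split: list.split)
qed

lemma computable_nat_const [computable]: "computable_nat Z k (\<lambda>xs. n)"
proof (induction n)
  case 0
  show ?case unfolding computable_nat_def by (rule exI[of _ Zero]) auto
qed (rule computable_nat_Suc)

lemma computable_nat_rec:
  assumes N: "computable_nat Z k N" and F: "computable_nat Z k F"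
    and G: "computable_nat Z (Suc (Suc k)) G"
  shows "computable_nat Z k (\<lambda>xs. rec_nat (F xs) (\<lambda>n v. G (n # v # xs)) (N xs))"
proof -
  define R where "R = (\<lambda>ys. rec_nat (F (tl ys)) (\<lambda>n v. G (n # v # tl ys)) (hd ys))"
  obtain p where p: "\<And>xs. length xs = k \<Longrightarrow> run Z p xs = Some (F xs)"
    using F by (auto simp: computable_nat_def)
  obtain r where r: "\<And>xs. length xs = Suc (Suc k) \<Longrightarrow> run Z r xs = Some (G xs)"
    using G by (auto simp: computable_nat_def)
  have "rec_nat (run Z p xs) (\<lambda>n r'. Option.bind r' (\<lambda>v. run Z r (n # v # xs))) m
      = Some (rec_nat (F xs) (\<lambda>n v. G (n # v # xs)) m)" if "length xs = k" for xs m
    using that by (induction m) (auto simp: p r)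
  then have "run Z (Prec p r) ys = Some (R ys)" if "length ys = Suc k" for ys
    using that by (cases ys) (auto simp: R_def)
  then have R: "computable_nat Z (Suc k) R"
    unfolding computable_nat_def by blast
  have *: "computable_nat Z k (\<lambda>xs. R (map (\<lambda>H. H xs) (N # map (\<lambda>i xs. xs ! i) [0..<k])))"
    by (rule computable_nat_compose) (use R N in \<open>auto intro!: computable\<close>)
  have "R (map (\<lambda>H. H xs) (N # map (\<lambda>i xs. xs ! i) [0..<k]))
      = rec_nat (F xs) (\<lambda>n v. G (n # v # xs)) (N xs)" if "length xs = k" for xs
  proof -
    have "map ((\<lambda>H. H xs) \<circ> (\<lambda>i xs. xs ! i)) [0..<k] = xs"
      using that map_nth[of xs] by (simp add: comp_def)
    then show ?thesis by (simp add: R_def)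
  qed
  from computable_nat_cong[THEN iffD1, OF this *] show ?thesis by simp
qed

lemma computable_nat_add [computable]:
  assumes "computable_nat Z k F" "computable_nat Z k G"
  shows "computable_nat Z k (\<lambda>xs. F xs + G xs)"
proof -
  have "rec_nat y (\<lambda>n v. Suc v) x = x + y" for x y :: nat
    by (induction x) auto
  then show ?thesis
    using computable_nat_rec[OF assms, of "\<lambda>ys. Suc (ys ! 1)"] by (simp add: computable)
qed

lemma computable_nat_mult [computable]:
  assumes "computable_nat Z k F" "computable_nat Z k G"
  shows "computable_nat Z k (\<lambda>xs. F xs * G xs)"
proof (rule computable_nat_compose2[OF _ assms])
  have "rec_nat 0 (\<lambda>n v. v + y) x = x * y" for x y :: nat
    by (induction x) auto
  then show "computable_nat Z 2 (\<lambda>xs. xs ! 0 * xs ! 1)"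
    using computable_nat_rec[of Z 2 "\<lambda>xs. xs ! 0" "\<lambda>xs. 0" "\<lambda>ys. ys ! 1 + ys ! 3"]
    by (simp add: computable)
qed

lemma computable_nat_power [computable]:
  assumes "computable_nat Z k F" "computable_nat Z k G"
  shows "computable_nat Z k (\<lambda>xs. F xs ^ G xs)"
proof (rule computable_nat_compose2[OF _ assms])
  have "rec_nat 1 (\<lambda>n v. v * y) x = y ^ x" for x y :: nat
    by (induction x) auto
  then show "computable_nat Z 2 (\<lambda>xs. xs ! 0 ^ xs ! 1)"
    using computable_nat_rec[of Z 2 "\<lambda>xs. xs ! 1" "\<lambda>xs. 1" "\<lambda>ys. ys ! 1 * ys ! 2"]
    by (simp add: computable)
qed

lemma computable_nat_diff [computable]:
  assumes "computable_nat Z k F" "computable_nat Z k G"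
  shows "computable_nat Z k (\<lambda>xs. F xs - G xs)"
proof (rule computable_nat_compose2[OF _ assms])
  have "rec_nat 0 (\<lambda>n v. n) x = x - 1" for x :: nat
    by (induction x) auto
  then have "computable_nat Z 1 (\<lambda>xs. xs ! 0 - 1)"
    using computable_nat_rec[of Z 1 "\<lambda>xs. xs ! 0" "\<lambda>xs. 0" "\<lambda>ys. ys ! 0"]
    by (simp add: computable)
  then have pred: "computable_nat Z l (\<lambda>xs. H xs - 1)" if "computable_nat Z l H" for H l
    using that by (rule computable_nat_compose1)
  have "rec_nat x (\<lambda>n v. v - 1) y = x - y" for x y :: nat
    by (induction y) auto
  then show "computable_nat Z 2 (\<lambda>xs. xs ! 0 - xs ! 1)"
    using computable_nat_rec[of Z 2 "\<lambda>xs. xs ! 1" "\<lambda>xs. xs ! 0" "\<lambda>ys. ys ! 1 - 1"]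
    by (simp add: computable pred del: One_nat_def)
qed

lemma computable_nat_le [computable]:
  assumes "computable_nat Z k F" "computable_nat Z k G"
  shows "computable_nat Z k (\<lambda>xs. of_bool (F xs \<le> G xs))"
proof -
  have "of_bool (x \<le> y) = 1 - (x - y)" for x y :: nat
    by auto
  then show ?thesis by (simp only:) (intro computable assms)
qed

lemma computable_nat_if [computable]:
  assumes "computable_nat Z k (\<lambda>xs. of_bool (P xs))" "computable_nat Z k F" "computable_nat Z k G"
  shows "computable_nat Z k (\<lambda>xs. if P xs then F xs else G xs)"
proof -
  have "(if P xs then F xs else G xs) = of_bool (P xs) * F xs + (1 - of_bool (P xs)) * G xs" for xs
    by auto
  then show ?thesis by (simp only:) (intro computable assms)
qed

lemma computable_nat_less [computable]:
  assumes "computable_nat Z k F" "computable_nat Z k G"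
  shows "computable_nat Z k (\<lambda>xs. of_bool (F xs < G xs))"
  unfolding Suc_le_eq[symmetric] by (intro computable assms)

lemma computable_nat_eq [computable]:
  assumes "computable_nat Z k F" "computable_nat Z k G"
  shows "computable_nat Z k (\<lambda>xs. of_bool (F xs = G xs))"
proof -
  have "of_bool (x = y) = of_bool (x \<le> y) * (of_bool (y \<le> x) :: nat)" for x y :: nat
    by auto
  then show ?thesis by (simp only:) (intro computable assms)
qed

text \<open>The recursor hands its step function the counter and the running value in front of the
  parameters; a summand that depends only on the counter has to skip the running value.\<close>

lemma computable_nat_skip:
  assumes "computable_nat Z (Suc k) G"
  shows "computable_nat Z (Suc (Suc k)) (\<lambda>ys. G (ys ! 0 # drop 2 ys))"
proof -
  have "length (map (\<lambda>i (ys :: nat list). ys ! i) (0 # [2..<Suc (Suc k)])) = Suc k"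
    by simp arith
  then have *: "computable_nat Z (Suc (Suc k))
      (\<lambda>ys. G (map (\<lambda>H. H ys) (map (\<lambda>i ys. ys ! i) (0 # [2..<Suc (Suc k)]))))"
    by (intro computable_nat_compose) (use assms in \<open>auto simp: simp del: upt_Suc intro!: computable\<close>)
  have "G (map (\<lambda>H. H ys) (map (\<lambda>i ys. ys ! i) (0 # [2..<Suc (Suc k)])))
      = G (ys ! 0 # drop 2 ys)" if "length ys = Suc (Suc k)" for ys
    using that by (intro arg_cong[of _ _ G] nth_equalityI)
      (auto simp: nth_Cons simp del: upt_Suc split: nat.splits)
  from computable_nat_cong[THEN iffD1, OF this *] show ?thesis by simp
qed

lemma computable_nat_sum:
  assumes "computable_nat Z k N" and "computable_nat Z (Suc k) G"
  shows "computable_nat Z k (\<lambda>xs. \<Sum>i<N xs. G (i # xs))"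
proof -
  have "rec_nat 0 (\<lambda>n v. v + G (n # xs)) m = (\<Sum>i<m. G (i # xs))" for m xs
    by (induction m) auto
  then show ?thesis
    using computable_nat_rec[OF assms(1), of "\<lambda>xs. 0" "\<lambda>ys. ys ! 1 + G (ys ! 0 # drop 2 ys)",
        OF computable_nat_const
          computable_nat_add[OF computable_nat_nth computable_nat_skip[OF assms(2)]]]
    by simp
qed

lemma computable_nat_prod:
  assumes "computable_nat Z k N" and "computable_nat Z (Suc k) G"
  shows "computable_nat Z k (\<lambda>xs. \<Prod>i<N xs. G (i # xs))"
proof -
  have "rec_nat 1 (\<lambda>n v. v * G (n # xs)) m = (\<Prod>i<m. G (i # xs))" for m xs
    by (induction m) auto
  then show ?thesis
    using computable_nat_rec[OF assms(1), of "\<lambda>xs. 1" "\<lambda>ys. ys ! 1 * G (ys ! 0 # drop 2 ys)",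
        OF computable_nat_const
          computable_nat_mult[OF computable_nat_nth computable_nat_skip[OF assms(2)]]]
    by simp
qed

lemma computable_nat_div [computable]:
  assumes "computable_nat Z k F" "computable_nat Z k G"
  shows "computable_nat Z k (\<lambda>xs. F xs div G xs)"
proof (rule computable_nat_compose2[OF _ assms])
  (* the quotient counts the positive multiples of y up to x *)
  have "x div y = (if y = 0 then 0 else \<Sum>i<x. of_bool (Suc i * y \<le> x))" for x y :: nat
  proof (cases "y = 0")
    case False
    have "{i. i < x \<and> Suc i * y \<le> x} = {..<x div y}"
      using False by (auto simp: Suc_le_eq[symmetric] less_eq_div_iff_mult_less_eq)
        (metis Suc_le_eq div_le_dividend less_eq_div_iff_mult_less_eq mult_Suc order_trans)
    then show ?thesis using False
      by (simp add: Int_def flip: of_bool_def)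
  qed auto
  moreover have "computable_nat Z 2 (\<lambda>xs. \<Sum>i<xs ! 0. of_bool (Suc i * xs ! 1 \<le> xs ! 0))"
    using computable_nat_sum[of Z 2 "\<lambda>xs. xs ! 0"
        "\<lambda>ys. of_bool (Suc (ys ! 0) * ys ! 2 \<le> ys ! 1)"]
    by (simp add: computable)
  ultimately show "computable_nat Z 2 (\<lambda>xs. xs ! 0 div xs ! 1)"
    by (simp only:) (intro computable; simp)
qed

lemma computable_nat_mod [computable]:
  assumes "computable_nat Z k F" "computable_nat Z k G"
  shows "computable_nat Z k (\<lambda>xs. F xs mod G xs)"
  unfolding modulo_nat_def by (intro computable assms)

section \<open>Computable rational-valued functions\<close>

text \<open>Sign and modulus are convenient for multiplication, a difference of two natural numbers
  for addition; the next two lemmas pass between the two representations.\<close>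

lemma computable_rat_diffE:
  assumes "computable_rat Z k f"
  obtains P N D where "computable_nat Z k P" "computable_nat Z k N" "computable_nat Z k D"
    "\<And>xs. length xs = k \<Longrightarrow> D xs \<noteq> 0"
    "\<And>xs. length xs = k \<Longrightarrow> f xs = (of_nat (P xs) - of_nat (N xs)) / of_nat (D xs)"
proof -
  obtain s a b where *: "computable_nat Z k s" "computable_nat Z k a" "computable_nat Z k b"
    "\<And>xs. length xs = k \<Longrightarrow> b xs \<noteq> 0 \<and> f xs = (-1) ^ s xs * of_nat (a xs) / of_nat (b xs)"
    using assms unfolding computable_rat_def by blast
  define P where "P = (\<lambda>xs. if s xs mod 2 = 0 then a xs else 0)"
  define N where "N = (\<lambda>xs. if s xs mod 2 = 0 then 0 else a xs)"
  have "computable_nat Z k P" "computable_nat Z k N"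
    unfolding P_def N_def by (intro computable *)+
  moreover have "f xs = (of_nat (P xs) - of_nat (N xs)) / of_nat (b xs)" if "length xs = k" for xs
    using *(4)[OF that] by (auto simp: P_def N_def minus_one_power_iff even_iff_mod_2_eq_zero)
  ultimately show ?thesis using * that by blast
qed

lemma computable_rat_diffI:
  assumes "computable_nat Z k P" "computable_nat Z k N" "computable_nat Z k D"
    and "\<And>xs. length xs = k \<Longrightarrow> D xs \<noteq> 0"
    and "\<And>xs. length xs = k \<Longrightarrow> f xs = (of_nat (P xs) - of_nat (N xs)) / of_nat (D xs)"
  shows "computable_rat Z k f"
  unfolding computable_rat_def
proof (intro exI conjI allI impI)
  show "computable_nat Z k (\<lambda>xs. of_bool (P xs < N xs))"
    "computable_nat Z k (\<lambda>xs. (P xs - N xs) + (N xs - P xs))" "computable_nat Z k D"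
    by (intro computable assms)+
qed (use assms(4,5) in \<open>auto simp: of_nat_diff\<close>)

lemma computable_rat_of_nat [computable]:
  "computable_nat Z k F \<Longrightarrow> computable_rat Z k (\<lambda>xs. of_nat (F xs))"
  by (rule computable_rat_diffI[of Z k F "\<lambda>_. 0" "\<lambda>_. 1"]) (auto intro: computable)

lemma computable_rat_const [computable]: "computable_rat Z k (\<lambda>xs. q)"
proof -
  obtain a b where q: "quotient_of q = (a, b)" by fastforce
  have "b > 0" using q by (rule quotient_of_denom_pos)
  have "(of_nat (nat a) - of_nat (nat (- a)) :: rat) = of_int a"
    by (cases "a \<ge> 0") simp_all
  moreover have "(of_nat (nat b) :: rat) = of_int b"
    using \<open>b > 0\<close> by simp
  ultimately have "q = (of_nat (nat a) - of_nat (nat (- a))) / of_nat (nat b)"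
    by (simp only: quotient_of_div[OF q])
  then show ?thesis
    using \<open>b > 0\<close>
    by (intro computable_rat_diffI[of Z k "\<lambda>_. nat a" "\<lambda>_. nat (- a)" "\<lambda>_. nat b"]
        computable_nat_const) simp_all
qed

lemma computable_rat_diff [computable]:
  assumes "computable_rat Z k f" "computable_rat Z k g"
  shows "computable_rat Z k (\<lambda>xs. f xs - g xs)"
proof -
  obtain P N D where *: "computable_nat Z k P" "computable_nat Z k N" "computable_nat Z k D"
    "\<And>xs. length xs = k \<Longrightarrow> D xs \<noteq> 0"
    "\<And>xs. length xs = k \<Longrightarrow> f xs = (of_nat (P xs) - of_nat (N xs)) / of_nat (D xs)"
    using assms(1) by (elim computable_rat_diffE) (rule that)
  obtain P' N' D' where **: "computable_nat Z k P'" "computable_nat Z k N'" "computable_nat Z k D'"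
    "\<And>xs. length xs = k \<Longrightarrow> D' xs \<noteq> 0"
    "\<And>xs. length xs = k \<Longrightarrow> g xs = (of_nat (P' xs) - of_nat (N' xs)) / of_nat (D' xs)"
    using assms(2) by (elim computable_rat_diffE) (rule that)
  show ?thesis
  proof (rule computable_rat_diffI)
    show "computable_nat Z k (\<lambda>xs. P xs * D' xs + N' xs * D xs)"
      "computable_nat Z k (\<lambda>xs. N xs * D' xs + P' xs * D xs)"
      "computable_nat Z k (\<lambda>xs. D xs * D' xs)"
      by (intro computable * **)+
    show "f xs - g xs = (of_nat (P xs * D' xs + N' xs * D xs)
        - of_nat (N xs * D' xs + P' xs * D xs)) / of_nat (D xs * D' xs)"
      if "length xs = k" for xs
      using *(4)[OF that] **(4)[OF that]
      by (simp add: *(5)[OF that] **(5)[OF that] diff_frac_eq algebra_simps)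
  qed (use *(4) **(4) in simp)
qed

lemma computable_rat_add [computable]:
  assumes "computable_rat Z k f" "computable_rat Z k g"
  shows "computable_rat Z k (\<lambda>xs. f xs + g xs)"
proof -
  have "computable_rat Z k (\<lambda>xs. f xs - (0 - g xs))"
    by (intro computable assms)
  then show ?thesis by simp
qed

lemma computable_rat_mult [computable]:
  assumes "computable_rat Z k f" "computable_rat Z k g"
  shows "computable_rat Z k (\<lambda>xs. f xs * g xs)"
proof -
  obtain s a b where *: "computable_nat Z k s" "computable_nat Z k a" "computable_nat Z k b"
    "\<And>xs. length xs = k \<Longrightarrow> b xs \<noteq> 0 \<and> f xs = (-1) ^ s xs * of_nat (a xs) / of_nat (b xs)"
    using assms(1) unfolding computable_rat_def by blast
  obtain s' a' b' where **: "computable_nat Z k s'" "computable_nat Z k a'" "computable_nat Z k b'"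
    "\<And>xs. length xs = k \<Longrightarrow> b' xs \<noteq> 0 \<and> g xs = (-1) ^ s' xs * of_nat (a' xs) / of_nat (b' xs)"
    using assms(2) unfolding computable_rat_def by blast
  show ?thesis unfolding computable_rat_def
  proof (intro exI conjI allI impI)
    show "computable_nat Z k (\<lambda>xs. s xs + s' xs)" "computable_nat Z k (\<lambda>xs. a xs * a' xs)"
      "computable_nat Z k (\<lambda>xs. b xs * b' xs)"
      by (intro computable * **)+
  qed (use *(4) **(4) in \<open>auto simp: power_add\<close>)
qed

lemma computable_rat_inverse:
  assumes "computable_rat Z k f"
  shows "computable_rat Z k (\<lambda>xs. inverse (f xs))"
proof -
  obtain s a b where *: "computable_nat Z k s" "computable_nat Z k a" "computable_nat Z k b"
    "\<And>xs. length xs = k \<Longrightarrow> b xs \<noteq> 0 \<and> f xs = (-1) ^ s xs * of_nat (a xs) / of_nat (b xs)"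
    using assms unfolding computable_rat_def by blast
  show ?thesis unfolding computable_rat_def
  proof (intro exI conjI allI impI)
    show "computable_nat Z k s" "computable_nat Z k (\<lambda>xs. if a xs = 0 then 0 else b xs)"
      "computable_nat Z k (\<lambda>xs. if a xs = 0 then 1 else a xs)"
      by (intro computable *)+
  qed (use *(4) in \<open>auto simp: minus_one_power_iff\<close>)
qed

lemma computable_rat_divide [computable]:
  assumes "computable_rat Z k f" "computable_rat Z k g"
  shows "computable_rat Z k (\<lambda>xs. f xs / g xs)"
  unfolding divide_inverse by (intro computable computable_rat_inverse assms)

lemma computable_nat_rat_le [computable]:
  assumes "computable_rat Z k f" "computable_rat Z k g"
  shows "computable_nat Z k (\<lambda>xs. of_bool (f xs \<le> g xs))"
proof -
  obtain P N D where *: "computable_nat Z k P" "computable_nat Z k N" "computable_nat Z k D"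
    "\<And>xs. length xs = k \<Longrightarrow> D xs \<noteq> 0"
    "\<And>xs. length xs = k \<Longrightarrow> g xs - f xs = (of_nat (P xs) - of_nat (N xs)) / of_nat (D xs)"
    using computable_rat_diff[OF assms(2,1)] by (elim computable_rat_diffE) (rule that)
  have "of_bool (N xs \<le> P xs) = (of_bool (f xs \<le> g xs) :: nat)" if "length xs = k" for xs
  proof -
    have "f xs \<le> g xs \<longleftrightarrow> 0 \<le> (of_nat (P xs) - of_nat (N xs) :: rat) / of_nat (D xs)"
      using *(5)[OF that] by (metis diff_ge_0_iff_ge)
    also have "\<dots> \<longleftrightarrow> N xs \<le> P xs"
      using *(4)[OF that] by (simp add: zero_le_divide_iff)
    finally show ?thesis by simp
  qed
  moreover have "computable_nat Z k (\<lambda>xs. of_bool (N xs \<le> P xs))"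
    by (intro computable *)
  ultimately show ?thesis
    by (rule computable_nat_cong[THEN iffD1])
qed

lemma computable_rat_sum:
  assumes N: "computable_nat Z k N" and "computable_rat Z (Suc k) g"
  shows "computable_rat Z k (\<lambda>xs. \<Sum>i<N xs. g (i # xs))"
proof -
  obtain P M D where *: "computable_nat Z (Suc k) P" "computable_nat Z (Suc k) M"
    "computable_nat Z (Suc k) D" "\<And>xs. length xs = Suc k \<Longrightarrow> D xs \<noteq> 0"
    "\<And>xs. length xs = Suc k \<Longrightarrow> g xs = (of_nat (P xs) - of_nat (M xs)) / of_nat (D xs)"
    using assms(2) by (elim computable_rat_diffE) (rule that)
  (* all summands are brought to the common denominator E *)
  define E where "E = (\<lambda>xs. \<Prod>i<N xs. D (i # xs))"
  have E: "computable_nat Z k E"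
    unfolding E_def by (intro computable_nat_prod N *)
  have "computable_nat Z (Suc k) (\<lambda>ys. E (map (\<lambda>H. H ys) (map (\<lambda>i ys. ys ! Suc i) [0..<k])))"
    by (rule computable_nat_compose) (use E in \<open>auto intro!: computable\<close>)
  moreover have "E (map (\<lambda>H. H ys) (map (\<lambda>i ys. ys ! Suc i) [0..<k])) = E (tl ys)"
    if "length ys = Suc k" for ys
    using that by (intro arg_cong[of _ _ E] nth_equalityI) (auto simp: nth_tl)
  ultimately have tl: "computable_nat Z (Suc k) (\<lambda>ys. E (tl ys))"
    by (subst computable_nat_cong[of _ _ "\<lambda>ys. E (map (\<lambda>H. H ys) (map (\<lambda>i ys. ys ! Suc i) [0..<k]))"])
      simp_all
  have E0: "E xs \<noteq> 0" if "length xs = k" for xs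
    using that *(4) by (simp add: E_def)
  have summand: "g (i # xs) = (of_nat (P (i # xs) * (E xs div D (i # xs)))
      - of_nat (M (i # xs) * (E xs div D (i # xs)))) / of_nat (E xs)"
    if "length xs = k" "i < N xs" for i xs
  proof -
    have "D (i # xs) dvd E xs"
      using that unfolding E_def by (intro dvd_prodI) auto
    then obtain u where u: "E xs = D (i # xs) * u" ..
    moreover have "D (i # xs) \<noteq> 0" "u \<noteq> 0"
      using E0[OF that(1)] u by auto
    moreover have "E xs div D (i # xs) = u"
      using u \<open>D (i # xs) \<noteq> 0\<close> by simp
    moreover have "g (i # xs) = (of_nat (P (i # xs)) - of_nat (M (i # xs))) / of_nat (D (i # xs))"
      using that by (intro *(5)) simp
    ultimately show ?thesis
      by (simp add: right_diff_distrib[symmetric] left_diff_distrib[symmetric])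
  qed
  show ?thesis
  proof (rule computable_rat_diffI)
    show "computable_nat Z k (\<lambda>xs. \<Sum>i<N xs. P (i # xs) * (E xs div D (i # xs)))"
      using computable_nat_sum[OF N, of "\<lambda>ys. P ys * (E (tl ys) div D ys)"]
      by (simp add: computable * tl)
    show "computable_nat Z k (\<lambda>xs. \<Sum>i<N xs. M (i # xs) * (E xs div D (i # xs)))"
      using computable_nat_sum[OF N, of "\<lambda>ys. M ys * (E (tl ys) div D ys)"]
      by (simp add: computable * tl)
    show "(\<Sum>i<N xs. g (i # xs)) = (of_nat (\<Sum>i<N xs. P (i # xs) * (E xs div D (i # xs)))
        - of_nat (\<Sum>i<N xs. M (i # xs) * (E xs div D (i # xs)))) / of_nat (E xs)"
      if "length xs = k" for xs
      using that by (simp add: summand sum_subtractf flip: sum_divide_distrib del: of_nat_mult)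
  qed (use E E0 in auto)
qed

lemma computable_rat_prod:
  assumes N: "computable_nat Z k N" and "computable_rat Z (Suc k) g"
  shows "computable_rat Z k (\<lambda>xs. \<Prod>i<N xs. g (i # xs))"
proof -
  obtain s a b where *: "computable_nat Z (Suc k) s" "computable_nat Z (Suc k) a"
    "computable_nat Z (Suc k) b" "\<And>xs. length xs = Suc k \<Longrightarrow>
      b xs \<noteq> 0 \<and> g xs = (-1) ^ s xs * of_nat (a xs) / of_nat (b xs)"
    using assms(2) unfolding computable_rat_def by blast
  show ?thesis unfolding computable_rat_def
  proof (intro exI conjI allI impI)
    show "computable_nat Z k (\<lambda>xs. \<Sum>i<N xs. s (i # xs))"
      "computable_nat Z k (\<lambda>xs. \<Prod>i<N xs. a (i # xs))"
      "computable_nat Z k (\<lambda>xs. \<Prod>i<N xs. b (i # xs))"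
      by (intro computable_nat_sum computable_nat_prod N *)+
  qed (use *(4) in \<open>auto simp: prod_dividef prod.distrib power_sum\<close>)
qed

lemma computable_rat_compose1 [computable]:
  assumes "computable_rat Z 1 f" "computable_nat Z k F"
  shows "computable_rat Z k (\<lambda>xs. f [F xs])"
proof -
  obtain s a b where *: "computable_nat Z 1 s" "computable_nat Z 1 a" "computable_nat Z 1 b"
    "\<And>xs. length xs = 1 \<Longrightarrow> b xs \<noteq> 0 \<and> f xs = (-1) ^ s xs * of_nat (a xs) / of_nat (b xs)"
    using assms(1) unfolding computable_rat_def by blast
  have "computable_nat Z k (\<lambda>xs. H [F xs])" if "computable_nat Z 1 H" for H
    using computable_nat_compose[of Z "[F]" H k] that assms(2) by simp
  then show ?thesis unfolding computable_rat_def
    using * by (intro exI[of _ "\<lambda>xs. s [F xs]"] exI[of _ "\<lambda>xs. a [F xs]"]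
      exI[of _ "\<lambda>xs. b [F xs]"]) auto
qed

lemma computable_rat_compose2 [computable]:
  assumes "computable_rat Z 2 f" "computable_nat Z k F" "computable_nat Z k G"
  shows "computable_rat Z k (\<lambda>xs. f [F xs, G xs])"
proof -
  obtain s a b where *: "computable_nat Z 2 s" "computable_nat Z 2 a" "computable_nat Z 2 b"
    "\<And>xs. length xs = 2 \<Longrightarrow> b xs \<noteq> 0 \<and> f xs = (-1) ^ s xs * of_nat (a xs) / of_nat (b xs)"
    using assms(1) unfolding computable_rat_def by blast
  have "computable_nat Z k (\<lambda>xs. H [F xs, G xs])" if "computable_nat Z 2 H" for H
    using computable_nat_compose[of Z "[F, G]" H k] that assms(2,3)
    by (auto simp: numeral_2_eq_2)
  then show ?thesis unfolding computable_rat_def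
    using * by (intro exI[of _ "\<lambda>xs. s [F xs, G xs]"] exI[of _ "\<lambda>xs. a [F xs, G xs]"]
      exI[of _ "\<lambda>xs. b [F xs, G xs]"]) auto
qed

section \<open>Operations on codes of strings\<close>

lemma string_code_Nil [simp]: "string_code [] = 1"
  by (simp add: string_code_def)

lemma string_code_snoc [simp]: "string_code (\<sigma> @ [b]) = 2 * string_code \<sigma> + of_bool b"
  by (simp add: string_code_def)

lemma string_code_bounds: "2 ^ length \<sigma> \<le> string_code \<sigma>" "string_code \<sigma> < 2 ^ Suc (length \<sigma>)"
  by (induction \<sigma> rule: rev_induct) (auto simp: of_bool_def)

lemma string_code_append:
  "string_code (\<sigma> @ \<tau>) = string_code \<sigma> * 2 ^ length \<tau> + (string_code \<tau> - 2 ^ length \<tau>)"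
proof (induction \<tau> rule: rev_induct)
  case (snoc b \<tau>)
  then show ?case
    using string_code_bounds(1)[of \<tau>] string_code_snoc[of "\<sigma> @ \<tau>" b] by (simp add: algebra_simps)
qed simp

lemma string_code_pos: "0 < string_code \<sigma>"
  by (rule less_le_trans[OF _ string_code_bounds(1)]) simp

lemma string_code_eq_1_iff: "string_code \<sigma> = 1 \<longleftrightarrow> \<sigma> = []"
proof (cases \<sigma> rule: rev_cases)
  case (snoc \<tau> b)
  then show ?thesis
    using string_code_pos[of \<tau>] by (simp add: snoc)
qed simp

lemma inj_string_code: "inj string_code"
proof
  fix \<sigma> \<tau> assume "string_code \<sigma> = string_code \<tau>"
  then show "\<sigma> = \<tau>"
  proof (induction \<sigma> arbitrary: \<tau> rule: rev_induct)
    case Nil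
    then show ?case by (metis string_code_Nil string_code_eq_1_iff)
  next
    case (snoc b \<sigma>)
    then have "\<tau> \<noteq> []"
      using string_code_eq_1_iff[of "\<sigma> @ [b]"] by auto
    then obtain \<tau>' c where \<tau>: "\<tau> = \<tau>' @ [c]" by (cases \<tau> rule: rev_cases) auto
    have "2 * string_code \<sigma> + of_bool b = 2 * string_code \<tau>' + of_bool c"
      using snoc.prems by (simp add: \<tau>)
    then have "string_code \<sigma> = string_code \<tau>'" "b = c"
      by (cases b; cases c; simp; presburger)+
    then show ?case using snoc.IH \<tau> by simp
  qed
qed

lemma string_code_surj:
  assumes "c > 0"
  shows "c \<in> range string_code"
  using assms
proof (induction c rule: less_induct)
  case (less c)
  show ?case
  proof (cases "c = 1")
    case True
    then show ?thesis by (intro image_eqI[of _ _ "[]"]) auto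
  next
    case False
    then obtain \<sigma> where "c div 2 = string_code \<sigma>"
      using less.IH[of "c div 2"] less.prems by force
    then have "c = string_code (\<sigma> @ [odd c])"
      by simp presburger
    then show ?thesis by blast
  qed
qed

text \<open>The length of a string is the exponent of the largest power of 2 below its code; deleting the
  last \<open>j\<close> bits divides the code by \<open>2 ^ j\<close>.\<close>

definition code_length :: "nat \<Rightarrow> nat" where
  "code_length c = (\<Sum>i<c. of_bool (2 ^ Suc i \<le> c))"

lemma code_length_string_code [simp]: "code_length (string_code \<sigma>) = length \<sigma>"
proof -
  have "2 ^ Suc i \<le> string_code \<sigma> \<longleftrightarrow> i < length \<sigma>" for i
  proof
    assume "2 ^ Suc i \<le> string_code \<sigma>"
    then have "(2 :: nat) ^ Suc i < 2 ^ Suc (length \<sigma>)"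
      using string_code_bounds(2) by (rule le_less_trans)
    then show "i < length \<sigma>" by (subst (asm) power_strict_increasing_iff) auto
  next
    assume "i < length \<sigma>"
    then have "(2 :: nat) ^ Suc i \<le> 2 ^ length \<sigma>"
      by (intro power_increasing) auto
    then show "2 ^ Suc i \<le> string_code \<sigma>"
      using string_code_bounds(1) by (rule order_trans)
  qed
  moreover have "length \<sigma> \<le> string_code \<sigma>"
    using string_code_bounds(1)[of \<sigma>] less_exp[of "length \<sigma>"] by linarith
  then have "{..<string_code \<sigma>} \<inter> {i. i < length \<sigma>} = {..<length \<sigma>}"
    by auto
  ultimately show ?thesis
    by (simp add: code_length_def)
qed

lemma computable_nat_code_length [computable]:
  assumes "computable_nat Z k F"
  shows "computable_nat Z k (\<lambda>xs. code_length (F xs))"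
proof (rule computable_nat_compose1[OF _ assms])
  show "computable_nat Z 1 (\<lambda>xs. code_length (xs ! 0))"
    unfolding code_length_def
    using computable_nat_sum[of Z 1 "\<lambda>xs. xs ! 0" "\<lambda>ys. of_bool (2 ^ Suc (ys ! 0) \<le> ys ! 1)"]
    by (simp add: computable del: power_Suc)
qed

definition code_take :: "nat \<Rightarrow> nat \<Rightarrow> nat" where
  "code_take n c = c div 2 ^ (code_length c - n)"

lemma code_take_string_code [simp]:
  assumes "n \<le> length \<sigma>"
  shows "code_take n (string_code \<sigma>) = string_code (take n \<sigma>)"
proof -
  have "string_code (drop n \<sigma>) - 2 ^ length (drop n \<sigma>) < 2 ^ length (drop n \<sigma>)"
    using string_code_bounds[of "drop n \<sigma>"] by (simp only: power_Suc)
  then have "string_code (take n \<sigma> @ drop n \<sigma>) div 2 ^ length (drop n \<sigma>)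
      = string_code (take n \<sigma>)"
    unfolding string_code_append by (simp del: length_drop)
  then show ?thesis by (simp add: code_take_def)
qed

definition code_append :: "nat \<Rightarrow> nat \<Rightarrow> nat" where
  "code_append c e = c * 2 ^ code_length e + (e - 2 ^ code_length e)"

lemma code_append_string_code [simp]:
  "code_append (string_code \<sigma>) (string_code \<tau>) = string_code (\<sigma> @ \<tau>)"
  by (simp add: code_append_def string_code_append)

lemma computable_nat_code_take [computable]:
  "computable_nat Z k F \<Longrightarrow> computable_nat Z k G \<Longrightarrow>
    computable_nat Z k (\<lambda>xs. code_take (F xs) (G xs))"
  unfolding code_take_def by (intro computable)

lemma computable_nat_code_append [computable]:
  "computable_nat Z k F \<Longrightarrow> computable_nat Z k G \<Longrightarrow>
    computable_nat Z k (\<lambda>xs. code_append (F xs) (G xs))"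
  unfolding code_append_def by (intro computable)

definition computable_string :: "(nat \<Rightarrow> bool) \<Rightarrow> (bool list \<Rightarrow> bool list) \<Rightarrow> bool" where
  "computable_string Z g \<longleftrightarrow>
     (\<exists>G. computable_nat Z 1 (\<lambda>xs. G (xs ! 0)) \<and> (\<forall>\<sigma>. G (string_code \<sigma>) = string_code (g \<sigma>)))"

lemma computable_string_const [computable]: "computable_string Z (\<lambda>\<sigma>. \<rho>)"
  unfolding computable_string_def by (intro exI[of _ "\<lambda>_. string_code \<rho>"] conjI computable) simp

lemma computable_string_id [computable]: "computable_string Z (\<lambda>\<sigma>. \<sigma>)"
  unfolding computable_string_def by (intro exI[of _ "\<lambda>c. c"] conjI computable) simp_all

lemma computable_string_append [computable]:
  assumes "computable_string Z g" "computable_string Z h"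
  shows "computable_string Z (\<lambda>\<sigma>. g \<sigma> @ h \<sigma>)"
proof -
  obtain G H where "computable_nat Z 1 (\<lambda>xs. G (xs ! 0))" "computable_nat Z 1 (\<lambda>xs. H (xs ! 0))"
    "\<And>\<sigma>. G (string_code \<sigma>) = string_code (g \<sigma>)" "\<And>\<sigma>. H (string_code \<sigma>) = string_code (h \<sigma>)"
    using assms unfolding computable_string_def by blast
  then show ?thesis unfolding computable_string_def
    by (intro exI[of _ "\<lambda>c. code_append (G c) (H c)"] conjI computable) simp_all
qed

lemma computable_string_compose:
  assumes "computable_string Z g" "computable_string Z h"
  shows "computable_string Z (\<lambda>\<sigma>. g (h \<sigma>))"
proof -
  obtain G H where *: "computable_nat Z 1 (\<lambda>xs. G (xs ! 0))" "computable_nat Z 1 (\<lambda>xs. H (xs ! 0))"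
    "\<And>\<sigma>. G (string_code \<sigma>) = string_code (g \<sigma>)" "\<And>\<sigma>. H (string_code \<sigma>) = string_code (h \<sigma>)"
    using assms unfolding computable_string_def by blast
  then show ?thesis unfolding computable_string_def
    by (intro exI[of _ "\<lambda>c. G (H c)"] conjI computable_nat_compose1[OF *(1)]) simp_all
qed

lemma computable_string_butlast [computable]: "computable_string Z butlast"
  unfolding computable_string_def
proof (intro exI conjI allI)
  show "computable_nat Z 1 (\<lambda>xs. (\<lambda>c. if c = 1 then 1 else c div 2) (xs ! 0))"
    by (intro computable) simp_all
  show "(\<lambda>c. if c = 1 then 1 else c div 2) (string_code \<sigma>) = string_code (butlast \<sigma>)" for \<sigma>
    using string_code_eq_1_iff[of \<sigma>] by (cases \<sigma> rule: rev_cases) auto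
qed

text \<open>The last bit enters as a string of length at most one, because \<open>last []\<close> is unspecified.\<close>

lemma computable_string_last_bit [computable]:
  "computable_string Z (\<lambda>\<sigma>. drop (length \<sigma> - 1) \<sigma>)"
  unfolding computable_string_def
proof (intro exI conjI allI)
  show "computable_nat Z 1 (\<lambda>xs. (\<lambda>c. if c = 1 then 1 else 2 + c mod 2) (xs ! 0))"
    by (intro computable) simp_all
  show "(\<lambda>c. if c = 1 then 1 else 2 + c mod 2) (string_code \<sigma>)
      = string_code (drop (length \<sigma> - 1) \<sigma>)" for \<sigma>
  proof (cases \<sigma> rule: rev_cases)
    case (snoc \<tau> b)
    then show ?thesis
      using string_code_eq_1_iff[of \<sigma>] string_code_snoc[of "[]" b] by simp
  qed simp
qed

section \<open>Exactly computable functions on strings\<close>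

lemma exactly_computable_const [computable]: "exactly_computable Z (\<lambda>\<sigma>. of_rat q)"
  unfolding exactly_computable_def by (intro exI[of _ "\<lambda>_. q"] conjI computable) simp

lemma exactly_computable_add [computable]:
  assumes "exactly_computable Z d" "exactly_computable Z e"
  shows "exactly_computable Z (\<lambda>\<sigma>. d \<sigma> + e \<sigma>)"
proof -
  obtain f g where "computable_rat Z 1 f" "computable_rat Z 1 g"
    "\<And>\<sigma>. d \<sigma> = of_rat (f [string_code \<sigma>])" "\<And>\<sigma>. e \<sigma> = of_rat (g [string_code \<sigma>])"
    using assms unfolding exactly_computable_def by blast
  then show ?thesis unfolding exactly_computable_def
    by (intro exI[of _ "\<lambda>xs. f xs + g xs"] conjI computable) (simp_all add: of_rat_add)
qed

lemma exactly_computable_diff [computable]: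
  assumes "exactly_computable Z d" "exactly_computable Z e"
  shows "exactly_computable Z (\<lambda>\<sigma>. d \<sigma> - e \<sigma>)"
proof -
  obtain f g where "computable_rat Z 1 f" "computable_rat Z 1 g"
    "\<And>\<sigma>. d \<sigma> = of_rat (f [string_code \<sigma>])" "\<And>\<sigma>. e \<sigma> = of_rat (g [string_code \<sigma>])"
    using assms unfolding exactly_computable_def by blast
  then show ?thesis unfolding exactly_computable_def
    by (intro exI[of _ "\<lambda>xs. f xs - g xs"] conjI computable) (simp_all add: of_rat_diff)
qed

lemma exactly_computable_mult [computable]:
  assumes "exactly_computable Z d" "exactly_computable Z e"
  shows "exactly_computable Z (\<lambda>\<sigma>. d \<sigma> * e \<sigma>)"
proof -
  obtain f g where "computable_rat Z 1 f" "computable_rat Z 1 g"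
    "\<And>\<sigma>. d \<sigma> = of_rat (f [string_code \<sigma>])" "\<And>\<sigma>. e \<sigma> = of_rat (g [string_code \<sigma>])"
    using assms unfolding exactly_computable_def by blast
  then show ?thesis unfolding exactly_computable_def
    by (intro exI[of _ "\<lambda>xs. f xs * g xs"] conjI computable) (simp_all add: of_rat_mult)
qed

lemma exactly_computable_divide [computable]:
  assumes "exactly_computable Z d" "exactly_computable Z e"
  shows "exactly_computable Z (\<lambda>\<sigma>. d \<sigma> / e \<sigma>)"
proof -
  obtain f g where "computable_rat Z 1 f" "computable_rat Z 1 g"
    "\<And>\<sigma>. d \<sigma> = of_rat (f [string_code \<sigma>])" "\<And>\<sigma>. e \<sigma> = of_rat (g [string_code \<sigma>])"
    using assms unfolding exactly_computable_def by blast
  then show ?thesis unfolding exactly_computable_def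
    by (intro exI[of _ "\<lambda>xs. f xs / g xs"] conjI computable) (simp_all add: of_rat_divide)
qed

lemma exactly_computable_compose:
  assumes "exactly_computable Z d" "computable_string Z g"
  shows "exactly_computable Z (\<lambda>\<sigma>. d (g \<sigma>))"
proof -
  obtain f G where "computable_rat Z 1 f" "\<And>\<sigma>. d \<sigma> = of_rat (f [string_code \<sigma>])"
    "computable_nat Z 1 (\<lambda>xs. G (xs ! 0))" "\<And>\<sigma>. G (string_code \<sigma>) = string_code (g \<sigma>)"
    using assms unfolding exactly_computable_def computable_string_def by blast
  then show ?thesis unfolding exactly_computable_def
    by (intro exI[of _ "\<lambda>xs. f [G (xs ! 0)]"] conjI computable) simp_all
qed

lemma exactly_computable_sum_prefixes:
  assumes "exactly_computable Z d"
  shows "exactly_computable Z (\<lambda>\<sigma>. \<Sum>i<length \<sigma>. d (take (Suc i) \<sigma>))"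
proof -
  obtain f where f: "computable_rat Z 1 f" "\<And>\<sigma>. d \<sigma> = of_rat (f [string_code \<sigma>])"
    using assms unfolding exactly_computable_def by blast
  have "computable_rat Z 2 (\<lambda>ys. f [code_take (Suc (ys ! 0)) (ys ! 1)])"
    by (intro computable f) simp_all
  then have "computable_rat Z 1 (\<lambda>xs. \<Sum>i<code_length (xs ! 0). f [code_take (Suc i) (xs ! 0)])"
    using computable_rat_sum[of Z 1 "\<lambda>xs. code_length (xs ! 0)"
        "\<lambda>ys. f [code_take (Suc (ys ! 0)) (ys ! 1)]"]
    by (simp add: computable numeral_2_eq_2)
  then show ?thesis unfolding exactly_computable_def
    by (intro exI[of _ "\<lambda>xs. \<Sum>i<code_length (xs ! 0). f [code_take (Suc i) (xs ! 0)]"])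
      (simp add: f of_rat_sum)
qed

lemma exactly_computable_prod_prefixes:
  assumes "exactly_computable Z d"
  shows "exactly_computable Z (\<lambda>\<sigma>. \<Prod>i<length \<sigma>. d (take (Suc i) \<sigma>))"
proof -
  obtain f where f: "computable_rat Z 1 f" "\<And>\<sigma>. d \<sigma> = of_rat (f [string_code \<sigma>])"
    using assms unfolding exactly_computable_def by blast
  have "computable_rat Z 2 (\<lambda>ys. f [code_take (Suc (ys ! 0)) (ys ! 1)])"
    by (intro computable f) simp_all
  then have "computable_rat Z 1 (\<lambda>xs. \<Prod>i<code_length (xs ! 0). f [code_take (Suc i) (xs ! 0)])"
    using computable_rat_prod[of Z 1 "\<lambda>xs. code_length (xs ! 0)"
        "\<lambda>ys. f [code_take (Suc (ys ! 0)) (ys ! 1)]"]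
    by (simp add: computable numeral_2_eq_2)
  then show ?thesis unfolding exactly_computable_def
    by (intro exI[of _ "\<lambda>xs. \<Prod>i<code_length (xs ! 0). f [code_take (Suc i) (xs ! 0)]"])
      (simp add: f of_rat_prod)
qed

lemma exactly_computable_imp_computable_real:
  assumes "exactly_computable Z d"
  shows "computable_real Z d"
proof -
  obtain f where f: "computable_rat Z 1 f" "\<And>\<sigma>. d \<sigma> = of_rat (f [string_code \<sigma>])"
    using assms unfolding exactly_computable_def by blast
  then show ?thesis unfolding computable_real_def
    by (intro exI[of _ "\<lambda>xs. f [xs ! 0]"] conjI computable) simp_all
qed

text \<open>An exactly computable function is determined by the three programs for sign, numerator and
  denominator.\<close>

instance prog :: countable
  by countable_datatype

lemma countable_exactly_computable: "countable {d. exactly_computable Z d}"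
proof (rule countable_subset)
  let ?v = "\<lambda>p \<sigma>. the (run Z p [string_code \<sigma>])"
  show "{d. exactly_computable Z d} \<subseteq> range (\<lambda>(p, q, r) \<sigma>.
      of_rat ((-1) ^ ?v p \<sigma> * of_nat (?v q \<sigma>) / of_nat (?v r \<sigma>)))" (is "_ \<subseteq> range ?h")
  proof
    fix d assume "d \<in> {d. exactly_computable Z d}"
    then obtain f where f: "computable_rat Z 1 f" "\<And>\<sigma>. d \<sigma> = of_rat (f [string_code \<sigma>])"
      unfolding exactly_computable_def by blast
    then obtain s a b where *: "computable_nat Z 1 s" "computable_nat Z 1 a" "computable_nat Z 1 b"
      "\<And>xs. length xs = 1 \<Longrightarrow> f xs = (-1) ^ s xs * of_nat (a xs) / of_nat (b xs)"
      unfolding computable_rat_def by blast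
    then obtain p q r where "\<And>xs. length xs = 1 \<Longrightarrow> run Z p xs = Some (s xs)"
      "\<And>xs. length xs = 1 \<Longrightarrow> run Z q xs = Some (a xs)"
      "\<And>xs. length xs = 1 \<Longrightarrow> run Z r xs = Some (b xs)"
      unfolding computable_nat_def by metis
    then have "d = ?h (p, q, r)"
      by (simp add: fun_eq_iff f *)
    then show "d \<in> range ?h" by blast
  qed
qed simp

section \<open>Martingales\<close>

lemma martingaleI:
  assumes "\<And>\<sigma>. 0 \<le> d \<sigma>" and "\<And>\<sigma>. d (\<sigma> @ [False]) + d (\<sigma> @ [True]) = 2 * d \<sigma>"
  shows "martingale d"
  using assms by (simp add: martingale_def)

lemma martingale_nonneg: "martingale d \<Longrightarrow> 0 \<le> d \<sigma>"
  by (simp add: martingale_def)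

lemma martingale_children: "martingale d \<Longrightarrow> d (\<sigma> @ [False]) + d (\<sigma> @ [True]) = 2 * d \<sigma>"
  unfolding martingale_def by (metis field_sum_of_halves mult_2 add_divide_distrib)

lemma martingale_eq_0_snoc:
  assumes "martingale d" "d \<sigma> = 0"
  shows "d (\<sigma> @ [b]) = 0"
  using martingale_children[OF assms(1), of \<sigma>] martingale_nonneg[OF assms(1), of "\<sigma> @ [True]"]
    martingale_nonneg[OF assms(1), of "\<sigma> @ [False]"] assms(2)
  by (cases b) auto

lemma martingale_add_mult:
  assumes "martingale d" "martingale e" "0 \<le> a"
  shows "martingale (\<lambda>\<sigma>. d \<sigma> + a * e \<sigma>)"
proof (rule martingaleI)
  show "d (\<sigma> @ [False]) + a * e (\<sigma> @ [False]) + (d (\<sigma> @ [True]) + a * e (\<sigma> @ [True]))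
      = 2 * (d \<sigma> + a * e \<sigma>)" for \<sigma>
    using martingale_children[OF assms(1), of \<sigma>] martingale_children[OF assms(2), of \<sigma>]
    by (simp add: algebra_simps flip: distrib_left)
qed (use assms in \<open>simp add: martingale_nonneg\<close>)

lemma martingale_normalized_shift:
  assumes "martingale d"
  shows "martingale (\<lambda>\<sigma>. d (\<rho> @ \<sigma>) / d \<rho>)"
proof (rule martingaleI)
  show "d (\<rho> @ \<sigma> @ [False]) / d \<rho> + d (\<rho> @ \<sigma> @ [True]) / d \<rho> = 2 * (d (\<rho> @ \<sigma>) / d \<rho>)" for \<sigma>
    using martingale_children[OF assms, of "\<rho> @ \<sigma>"] by (simp flip: add_divide_distrib)
qed (use assms in \<open>simp add: martingale_nonneg\<close>)

lemma succeeds_onD: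
  assumes "succeeds_on d X"
  shows "\<exists>n\<ge>N. K \<le> d (initial X n)"
proof (rule ccontr)
  assume "\<not> ?thesis"
  then have "eventually (\<lambda>n. ereal (d (initial X n)) \<le> ereal K) sequentially"
    unfolding eventually_sequentially by (metis ereal_less_eq(3) linear)
  then have "limsup (\<lambda>n. ereal (d (initial X n))) \<le> ereal K"
    by (rule Limsup_bounded)
  with assms show False by (simp add: succeeds_on_def)
qed

text \<open>A sequence of real numbers that is unbounded above has infinite limes superior, as finitely
  many of its members are bounded.\<close>

lemma succeeds_onI:
  assumes "\<And>K. \<exists>n. K \<le> d (initial X n)"
  shows "succeeds_on d X"
proof (rule ccontr)
  assume "\<not> succeeds_on d X"
  then obtain K where "limsup (\<lambda>n. ereal (d (initial X n))) < ereal (real K)"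
    unfolding succeeds_on_def using less_PInf_Ex_of_nat by auto
  then have "eventually (\<lambda>n. ereal (d (initial X n)) < ereal (real K)) sequentially"
    by (rule Limsup_lessD)
  then obtain N where N: "\<And>n. n \<ge> N \<Longrightarrow> d (initial X n) < K"
    by (auto simp: eventually_sequentially)
  define M where "M = Max (insert (real K) ((\<lambda>n. d (initial X n)) ` {..<N}))"
  have "d (initial X n) \<le> M" for n
  proof (cases "n < N")
    case False
    then have "d (initial X n) \<le> real K" using N[of n] by simp
    also have "\<dots> \<le> M" by (simp add: M_def)
    finally show ?thesis .
  qed (simp add: M_def)
  moreover obtain n where "M + 1 \<le> d (initial X n)"
    using assms by blast
  ultimately show False by (metis add_le_same_cancel1 not_one_le_zero order_trans)
qed

lemma length_initial [simp]: "length (initial X n) = n"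
  by (simp add: initial_def)

lemma initial_add: "initial X (n + m) = initial X n @ initial (\<lambda>i. X (n + i)) m"
  unfolding initial_def by (rule nth_equalityI) (auto simp: nth_append)

lemma take_initial: "m \<le> n \<Longrightarrow> take m (initial X n) = initial X m"
  by (simp add: initial_def take_map)

lemma prefix_initialD:
  assumes "prefix \<tau> (initial X n)"
  shows "\<tau> = initial X (length \<tau>)"
proof -
  have "length \<tau> \<le> n" using prefix_length_le[OF assms] by simp
  then show ?thesis using assms take_initial[of "length \<tau>" n X] by (auto simp: prefix_def)
qed

text \<open>This places a sequence in the winning set of \<open>d\<close> and \<open>q\<close> as soon as \<open>d\<close> reaches
  \<open>q\<close> on one of its initial segments: the shortest such segment is minimal.\<close>

lemma minimal_such_initial:
  assumes "P (initial X n)"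
  obtains m where "minimal_such P (initial X m)"
proof -
  define m where "m = (LEAST n. P (initial X n))"
  have "P (initial X m)" unfolding m_def using assms by (rule LeastI)
  moreover have "\<not> P \<tau>" if "strict_prefix \<tau> (initial X m)" for \<tau>
  proof -
    have "\<tau> = initial X (length \<tau>)" "length \<tau> < m"
      using that prefix_initialD prefix_length_less by (fastforce simp: strict_prefix_def)+
    then show ?thesis using not_less_Least[of "length \<tau>" "\<lambda>n. P (initial X n)"] by (simp add: m_def)
  qed
  ultimately show ?thesis using that[of m] by (simp add: minimal_such_def)
qed

text \<open>Rational approximations \<open>g\<close> of \<open>d\<close> do not satisfy the averaging condition, but their
  differences between siblings can serve as stakes: passing from \<open>\<sigma>\<close> to \<open>\<sigma> b\<close>, the new
  martingale wins or loses half of that difference. If the error of \<open>g\<close> halves with each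
  bit, the total deviation from \<open>d\<close> is bounded, and a large enough initial capital absorbs it.\<close>

lemma exactly_computable_dominating_martingale:
  assumes "martingale d" "computable_real Z d"
  obtains d' where "martingale d'" "exactly_computable Z d'" "\<And>\<sigma>. d \<sigma> + 1 \<le> d' \<sigma>"
proof -
  obtain f where f: "computable_rat Z 2 f"
    "\<And>\<sigma> n. \<bar>d \<sigma> - of_rat (f [string_code \<sigma>, n])\<bar> \<le> (1 / 2) ^ n"
    using assms(2) unfolding computable_real_def by blast
  (* the code of a string exceeds its length, so it may serve as the precision *)
  define g :: "bool list \<Rightarrow> real" where "g = (\<lambda>\<sigma>. of_rat (f [string_code \<sigma>, string_code \<sigma>]))"
  define h where "h = (\<lambda>\<sigma>. g \<sigma> - (g (butlast \<sigma> @ [False]) + g (butlast \<sigma> @ [True])) / of_rat 2)"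
  (* of the surplus 3, at most 1 is lost to the error at the root and 1 to the stakes *)
  define d' where "d' = (\<lambda>\<sigma>. g [] + of_rat 3 + (\<Sum>i<length \<sigma>. h (take (Suc i) \<sigma>)))"
  have g: "exactly_computable Z g"
    unfolding exactly_computable_def g_def
    by (intro exI[of _ "\<lambda>xs. f [xs ! 0, xs ! 0]"] conjI computable f) simp_all
  have "exactly_computable Z h"
    unfolding h_def by (intro computable g exactly_computable_compose[OF g])
  then have "exactly_computable Z d'"
    unfolding d'_def
    by (intro computable exactly_computable_sum_prefixes exactly_computable_compose[OF g])
  have g_d: "\<bar>g \<sigma> - d \<sigma>\<bar> \<le> (1 / 2) ^ Suc (length \<sigma>)" for \<sigma>
  proof -
    have "Suc (length \<sigma>) \<le> 2 ^ length \<sigma>" using less_exp[of "length \<sigma>"] by (simp only: Suc_le_eq)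
    also have "\<dots> \<le> string_code \<sigma>" by (rule string_code_bounds)
    finally have "(1 / 2 :: real) ^ string_code \<sigma> \<le> (1 / 2) ^ Suc (length \<sigma>)"
      by (intro power_decreasing) auto
    then show ?thesis
      using f(2)[of \<sigma> "string_code \<sigma>"] by (simp add: g_def abs_minus_commute)
  qed
  have d'_snoc: "d' (\<sigma> @ [b]) = d' \<sigma> + (g (\<sigma> @ [b]) - g (\<sigma> @ [\<not> b])) / 2" for \<sigma> b
    by (cases b) (simp_all add: d'_def h_def field_simps)
  have error: "\<bar>(d' \<sigma> - d \<sigma>) - (g [] + 3 - d [])\<bar> \<le> 1 - (1 / 2) ^ length \<sigma>" for \<sigma>
  proof (induction \<sigma> rule: rev_induct)
    case (snoc b \<sigma>)
    have d_snoc: "d (\<sigma> @ [b]) = d \<sigma> + (d (\<sigma> @ [b]) - d (\<sigma> @ [\<not> b])) / 2"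
      using martingale_children[OF assms(1), of \<sigma>] by (cases b) (simp_all add: field_simps)
    have "\<bar>g (\<sigma> @ [c]) - d (\<sigma> @ [c])\<bar> \<le> (1 / 2) ^ length \<sigma> / 4" for c
      using g_d[of "\<sigma> @ [c]"] by simp
    from this[of b] this[of "\<not> b"]
    have "\<bar>(g (\<sigma> @ [b]) - g (\<sigma> @ [\<not> b])) / 2 - (d (\<sigma> @ [b]) - d (\<sigma> @ [\<not> b])) / 2\<bar>
        \<le> (1 / 2) ^ length \<sigma> / 2"
      by argo
    moreover have "(1 / 2 :: real) ^ length (\<sigma> @ [b]) = (1 / 2) ^ length \<sigma> / 2"
      by simp
    ultimately show ?case
      using snoc.IH d'_snoc[of \<sigma> b] d_snoc by linarith
  qed (simp add: d'_def)
  have dominates: "d \<sigma> + 1 \<le> d' \<sigma>" for \<sigma>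
    using error[of \<sigma>] g_d[of "[]"] zero_le_power[of "1 / 2 :: real" "length \<sigma>"]
    by (simp only: list.size power_Suc power_0) argo
  have "martingale d'"
  proof (rule martingaleI)
    show "0 \<le> d' \<sigma>" for \<sigma>
      using dominates[of \<sigma>] martingale_nonneg[OF assms(1), of \<sigma>] by linarith
  qed (simp add: d'_snoc field_simps)
  then show ?thesis using that \<open>exactly_computable Z d'\<close> dominates by blast
qed

section \<open>Restarting a martingale after each win\<close>

text \<open>The part of the input read since the last restart. It decides the next bet.\<close>

definition block :: "(bool list \<Rightarrow> real) \<Rightarrow> real \<Rightarrow> bool list \<Rightarrow> bool list" where
  "block e q = foldl (\<lambda>\<tau> b. if q \<le> e (\<tau> @ [b]) then [] else \<tau> @ [b]) []"

text \<open>Each bit multiplies the capital by the factor by which \<open>e\<close> changes on the current block. If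
  \<open>e\<close> has lost everything there, the factor is \<open>0 / 0 = 0\<close>, so that the capital stays 0.\<close>

definition restart :: "(bool list \<Rightarrow> real) \<Rightarrow> real \<Rightarrow> bool list \<Rightarrow> real" where
  "restart e q \<sigma> =
     (\<Prod>i<length \<sigma>. e (block e q (take i \<sigma>) @ [\<sigma> ! i]) / e (block e q (take i \<sigma>)))"

lemma block_Nil [simp]: "block e q [] = []"
  by (simp add: block_def)

lemma block_snoc [simp]:
  "block e q (\<sigma> @ [b]) = (if q \<le> e (block e q \<sigma> @ [b]) then [] else block e q \<sigma> @ [b])"
  by (simp add: block_def)

lemma restart_Nil [simp]: "restart e q [] = 1"
  by (simp add: restart_def)

lemma restart_snoc [simp]:
  "restart e q (\<sigma> @ [b]) = restart e q \<sigma> * (e (block e q \<sigma> @ [b]) / e (block e q \<sigma>))"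
  by (simp add: restart_def nth_append)

text \<open>Reading the bits from left to right, the code of the current block is carried along by a
  primitive recursion on the number of bits read.\<close>

lemma computable_string_block:
  assumes "exactly_computable Z e"
  shows "computable_string Z (block e (of_rat q))"
proof -
  obtain f where f: "computable_rat Z 1 f" "\<And>\<sigma>. e \<sigma> = of_rat (f [string_code \<sigma>])"
    using assms unfolding exactly_computable_def by blast
  define bit where "bit = (\<lambda>c j. code_take (Suc j) c mod 2)"
  define step where "step = (\<lambda>c j v. if q \<le> f [2 * v + bit c j] then 1 else 2 * v + bit c j)"
  define G where "G = (\<lambda>c. rec_nat 1 (step c) (code_length c))"
  have "computable_nat Z 3 (\<lambda>ys. step (ys ! 2) (ys ! 0) (ys ! 1))"
    unfolding step_def bit_def by (intro computable f) simp_all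
  then have "computable_nat Z 1 (\<lambda>xs. G (xs ! 0))"
    using computable_nat_rec[of Z 1 "\<lambda>xs. code_length (xs ! 0)" "\<lambda>_. 1"
        "\<lambda>ys. step (ys ! 2) (ys ! 0) (ys ! 1)"]
    by (simp add: G_def computable numeral_3_eq_3)
  moreover have "G (string_code \<sigma>) = string_code (block e (of_rat q) \<sigma>)" for \<sigma>
  proof -
    have "rec_nat 1 (step (string_code \<sigma>)) j = string_code (block e (of_rat q) (take j \<sigma>))"
      if "j \<le> length \<sigma>" for j
      using that
    proof (induction j)
      case (Suc j)
      then have take: "take (Suc j) \<sigma> = take j \<sigma> @ [\<sigma> ! j]"
        by (simp add: take_Suc_conv_app_nth)
      have "bit (string_code \<sigma>) j = of_bool (\<sigma> ! j)"
        using Suc.prems by (simp add: bit_def take)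
      moreover have "of_rat q \<le> e \<tau> \<longleftrightarrow> q \<le> f [string_code \<tau>]" for \<tau>
        by (simp add: f of_rat_less_eq)
      ultimately show ?case
        using Suc by (simp add: step_def take)
    qed simp
    from this[of "length \<sigma>"] show ?thesis by (simp add: G_def)
  qed
  ultimately show ?thesis unfolding computable_string_def by blast
qed

lemma exactly_computable_restart:
  assumes "exactly_computable Z e"
  shows "exactly_computable Z (restart e (of_rat q))"
proof -
  let ?b = "\<lambda>\<sigma>. block e (of_rat q) (butlast \<sigma>)"
  have b: "computable_string Z ?b"
    by (intro computable_string_compose[OF computable_string_block] computable assms)
  have "exactly_computable Z (\<lambda>\<sigma>. e (?b \<sigma> @ drop (length \<sigma> - 1) \<sigma>) / e (?b \<sigma>))"
    by (intro computable exactly_computable_compose[OF assms] b)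
  then have "exactly_computable Z (\<lambda>\<sigma>. \<Prod>i<length \<sigma>. (\<lambda>\<tau>.
      e (?b \<tau> @ drop (length \<tau> - 1) \<tau>) / e (?b \<tau>)) (take (Suc i) \<sigma>))"
    by (rule exactly_computable_prod_prefixes)
  moreover have "restart e (of_rat q) \<sigma> = (\<Prod>i<length \<sigma>. (\<lambda>\<tau>.
      e (?b \<tau> @ drop (length \<tau> - 1) \<tau>) / e (?b \<tau>)) (take (Suc i) \<sigma>))" for \<sigma>
    unfolding restart_def by (rule prod.cong) (auto simp: take_Suc_conv_app_nth)
  ultimately show ?thesis by presburger
qed

lemma martingale_restart:
  assumes "martingale e" "normed e"
  shows "martingale (restart e q)"
proof (rule martingaleI)
  show "0 \<le> restart e q \<sigma>" for \<sigma>
    unfolding restart_def by (intro prod_nonneg) (simp add: martingale_nonneg[OF assms(1)])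
  (* e has capital 1 after a restart, so a block on which e vanishes ends with a bit whose
     factor is 0 *)
  have ruined: "restart e q \<sigma> = 0" if "e (block e q \<sigma>) = 0" for \<sigma>
    using that assms(2)
    by (cases \<sigma> rule: rev_cases) (auto simp: normed_def split: if_splits)
  show "restart e q (\<sigma> @ [False]) + restart e q (\<sigma> @ [True]) = 2 * restart e q \<sigma>" for \<sigma>
  proof (cases "e (block e q \<sigma>) = 0")
    case False
    then show ?thesis
      using martingale_children[OF assms(1), of "block e q \<sigma>"]
      by (simp add: flip: distrib_left add_divide_distrib)
  qed (simp add: ruined)
qed

text \<open>Started afresh, \<open>restart e q\<close> copies \<open>e\<close> on all proper prefixes of a minimal winning
  string, since the threshold is not reached there, and starts afresh again at its end.\<close>

lemma restart_append_minimal: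
  assumes "martingale e" "normed e" "1 < q"
    and "block e q \<rho> = []" and "minimal_such (\<lambda>\<tau>. q \<le> e \<tau>) \<sigma>"
  shows "block e q (\<rho> @ \<sigma>) = []" "restart e q (\<rho> @ \<sigma>) = restart e q \<rho> * e \<sigma>"
proof -
  have e1: "e [] = 1" using assms(2) by (simp add: normed_def)
  have restart_snoc': "restart e q (\<rho> @ \<tau> @ [b]) = restart e q \<rho> * e (\<tau> @ [b])"
    if "block e q (\<rho> @ \<tau>) = \<tau>" "restart e q (\<rho> @ \<tau>) = restart e q \<rho> * e \<tau>" for \<tau> b
    using restart_snoc[of e q "\<rho> @ \<tau>" b] that martingale_eq_0_snoc[OF assms(1), of \<tau> b]
    by (cases "e \<tau> = 0") auto
  have inside: "block e q (\<rho> @ \<tau>) = \<tau> \<and> restart e q (\<rho> @ \<tau>) = restart e q \<rho> * e \<tau>"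
    if "strict_prefix \<tau> \<sigma>" for \<tau>
    using that
  proof (induction \<tau> rule: rev_induct)
    case (snoc b \<tau>)
    then have "strict_prefix \<tau> \<sigma>"
      by (auto simp: strict_prefix_def prefix_def)
    then have IH: "block e q (\<rho> @ \<tau>) = \<tau>" "restart e q (\<rho> @ \<tau>) = restart e q \<rho> * e \<tau>"
      using snoc.IH by blast+
    have "\<not> q \<le> e (\<tau> @ [b])"
      using assms(5) snoc.prems by (simp add: minimal_such_def)
    then show ?case
      using block_snoc[of e q "\<rho> @ \<tau>" b] restart_snoc' IH by simp
  qed (use assms(4) e1 in simp)
  have "q \<le> e \<sigma>" using assms(5) by (simp add: minimal_such_def)
  then have "\<sigma> \<noteq> []" using e1 assms(3) by auto
  then obtain \<tau> b where \<sigma>: "\<sigma> = \<tau> @ [b]" by (cases \<sigma> rule: rev_cases) auto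
  then have "block e q (\<rho> @ \<tau>) = \<tau>" "restart e q (\<rho> @ \<tau>) = restart e q \<rho> * e \<tau>"
    using inside[of \<tau>] by (auto simp: strict_prefix_def)
  then show "block e q (\<rho> @ \<sigma>) = []" "restart e q (\<rho> @ \<sigma>) = restart e q \<rho> * e \<sigma>"
    using block_snoc[of e q "\<rho> @ \<tau>" b] restart_snoc' \<open>q \<le> e \<sigma>\<close> by (simp_all add: \<sigma>)
qed

text \<open>\<open>P\<close> contains the positions at which \<open>X\<close> may be cut: from each of them a minimal
  winning string leads to another.\<close>

lemma succeeds_on_restart:
  assumes "martingale e" "normed e" "1 < q" and "0 \<in> P"
    and "\<And>n. n \<in> P \<Longrightarrow>
      \<exists>m. n + m \<in> P \<and> minimal_such (\<lambda>\<tau>. q \<le> e \<tau>) (initial (\<lambda>i. X (n + i)) m)"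
  shows "succeeds_on (restart e q) X"
proof -
  have wins: "\<exists>n\<in>P. block e q (initial X n) = [] \<and> q ^ k \<le> restart e q (initial X n)" for k
  proof (induction k)
    case 0
    then show ?case using assms(4) by (intro bexI[of _ 0]) (auto simp: initial_def)
  next
    case (Suc k)
    then obtain n where n: "n \<in> P" "block e q (initial X n) = []"
      "q ^ k \<le> restart e q (initial X n)" by blast
    then obtain m where m: "n + m \<in> P"
      "minimal_such (\<lambda>\<tau>. q \<le> e \<tau>) (initial (\<lambda>i. X (n + i)) m)" using assms(5) by blast
    note step = restart_append_minimal[OF assms(1-3) n(2) m(2), folded initial_add]
    have "q ^ k * q \<le> restart e q (initial X n) * e (initial (\<lambda>i. X (n + i)) m)"
      using n(3) m(2) assms(3) zero_le_power[of q k]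
      by (intro mult_mono) (auto simp: minimal_such_def martingale_nonneg[OF martingale_restart[OF assms(1,2)]])
    then show ?case
      using m(1) step by (auto simp: mult.commute)
  qed
  show ?thesis
  proof (rule succeeds_onI)
    fix K
    obtain k where "K < q ^ k" using real_arch_pow[OF assms(3)] by blast
    then show "\<exists>n. K \<le> restart e q (initial X n)"
      using wins[of k] by (meson less_imp_le order_trans)
  qed
qed

section \<open>A martingale that wins on all tails at once\<close>

text \<open>For every string \<open>\<rho>\<close>, of code \<open>c = Suc i\<close>, the fraction \<open>2\<^sup>-\<^sup>c\<close> of the initial
  capital is reserved. It is left untouched while the first \<open>c\<close> bits of \<open>\<tau>\<close> are read, and is
  then bet in the way \<open>d\<close> bets after \<open>\<rho>\<close>. Because of the waiting time, only the finitely
  many strings of code at most \<open>length \<tau>\<close> are active at \<open>\<tau>\<close>, and the value is a finite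
  rational sum; the idle reserves add up to \<open>2\<^sup>-\<^sup>n\<close> for \<open>n = length \<tau>\<close>.\<close>

definition tail_mixture :: "(bool list \<Rightarrow> real) \<Rightarrow> bool list \<Rightarrow> real" where
  "tail_mixture d \<tau> = (1 / 2) ^ length \<tau> + (\<Sum>i<length \<tau>. (1 / 2) ^ Suc i *
     (d (inv string_code (Suc i) @ \<tau>) / d (inv string_code (Suc i) @ take (Suc i) \<tau>)))"

lemma string_code_inv: "string_code (inv string_code (Suc i)) = Suc i"
  by (rule f_inv_into_f[OF string_code_surj]) simp

lemma martingale_tail_mixture:
  assumes "martingale d" "\<And>\<sigma>. 0 < d \<sigma>"
  shows "martingale (tail_mixture d)"
proof (rule martingaleI)
  show "0 \<le> tail_mixture d \<sigma>" for \<sigma>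
    unfolding tail_mixture_def
    by (intro add_nonneg_nonneg sum_nonneg) (simp_all add: martingale_nonneg[OF assms(1)])
  show "tail_mixture d (\<sigma> @ [False]) + tail_mixture d (\<sigma> @ [True]) = 2 * tail_mixture d \<sigma>" for \<sigma>
  proof -
    let ?s = "\<lambda>i. inv string_code (Suc i)"
    let ?t = "\<lambda>\<tau> i. (1 / 2) ^ Suc i * (d (?s i @ \<tau>) / d (?s i @ take (Suc i) \<sigma>))"
    (* the reserve that becomes active with the last bit has not been bet yet *)
    have snoc: "tail_mixture d (\<sigma> @ [b]) = (1 / 2) ^ length \<sigma> + (\<Sum>i<length \<sigma>. ?t (\<sigma> @ [b]) i)" for b
    proof -
      have nonzero: "d (?s (length \<sigma>) @ \<sigma> @ [b]) \<noteq> 0"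
        using assms(2) by (metis less_irrefl)
      then have "(1 / 2 :: real) ^ length \<sigma> = (1 / 2) ^ Suc (length \<sigma>) + (1 / 2) ^ Suc (length \<sigma>) *
          (d (?s (length \<sigma>) @ \<sigma> @ [b]) / d (?s (length \<sigma>) @ take (Suc (length \<sigma>)) (\<sigma> @ [b])))"
        by simp
      then show ?thesis by (simp add: tail_mixture_def nonzero)
    qed
    have "?t (\<sigma> @ [False]) i + ?t (\<sigma> @ [True]) i = 2 * ?t \<sigma> i" for i
    proof -
      have "d (?s i @ \<sigma> @ [False]) + d (?s i @ \<sigma> @ [True]) = 2 * d (?s i @ \<sigma>)"
        using martingale_children[OF assms(1), of "?s i @ \<sigma>"] by simp
      then show ?thesis
        by (simp del: power_Suc add: mult.left_commute
            flip: distrib_left add_divide_distrib times_divide_eq_right)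
    qed
    then have "(\<Sum>i<length \<sigma>. ?t (\<sigma> @ [False]) i) + (\<Sum>i<length \<sigma>. ?t (\<sigma> @ [True]) i)
        = 2 * (\<Sum>i<length \<sigma>. ?t \<sigma> i)"
      unfolding sum.distrib[symmetric] sum_distrib_left by (rule sum.cong[OF refl])
    then show ?thesis
      unfolding snoc tail_mixture_def[of d \<sigma>] by argo
  qed
qed

lemma exactly_computable_tail_mixture:
  assumes "exactly_computable Z d"
  shows "exactly_computable Z (tail_mixture d)"
proof -
  obtain f where f: "computable_rat Z 1 f" "\<And>\<sigma>. d \<sigma> = of_rat (f [string_code \<sigma>])"
    using assms unfolding exactly_computable_def by blast
  define w where "w = (\<lambda>n. 1 / of_nat (2 ^ n) :: rat)"
  have w: "computable_rat Z k (\<lambda>xs. w (F xs))" if "computable_nat Z k F" for k F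
    unfolding w_def by (intro computable that)
  define t where "t = (\<lambda>i c. w (Suc i) *
    (f [code_append (Suc i) c] / f [code_append (Suc i) (code_take (Suc i) c)]))"
  have "computable_rat Z 2 (\<lambda>ys. t (ys ! 0) (ys ! 1))"
    unfolding t_def by (intro computable f w) simp_all
  then have t: "computable_rat Z 1 (\<lambda>xs. \<Sum>i<code_length (xs ! 0). t i (xs ! 0))"
    using computable_rat_sum[of Z 1 "\<lambda>xs. code_length (xs ! 0)" "\<lambda>ys. t (ys ! 0) (ys ! 1)"]
    by (simp add: computable numeral_2_eq_2)
  show ?thesis unfolding exactly_computable_def
  proof (intro exI conjI allI)
    show "computable_rat Z 1
        (\<lambda>xs. w (code_length (xs ! 0)) + (\<Sum>i<code_length (xs ! 0). t i (xs ! 0)))"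
      by (intro computable w t) simp
    have "of_rat (t i (string_code \<tau>)) = (1 / 2) ^ Suc i *
        (d (inv string_code (Suc i) @ \<tau>) / d (inv string_code (Suc i) @ take (Suc i) \<tau>))"
      if "i < length \<tau>" for i \<tau>
    proof -
      have "code_append (Suc i) (string_code \<rho>) = string_code (inv string_code (Suc i) @ \<rho>)" for \<rho>
        by (simp add: string_code_inv flip: code_append_string_code)
      then show ?thesis
        using that by (simp add: t_def w_def f of_rat_mult of_rat_divide of_rat_power power_divide
            del: power_Suc)
    qed
    then show "tail_mixture d \<tau> = of_rat ((\<lambda>xs. w (code_length (xs ! 0))
        + (\<Sum>i<code_length (xs ! 0). t i (xs ! 0))) [string_code \<tau>])" for \<tau>
      by (simp add: tail_mixture_def of_rat_add of_rat_sum w_def of_rat_divide of_rat_power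
          power_divide del: power_Suc)
  qed
qed

text \<open>On the tail of \<open>X\<close> after \<open>\<rho> = initial X n\<close>, the share reserved for \<open>\<rho>\<close> alone
  grows beyond every bound, because it follows the values of \<open>d\<close> along \<open>X\<close> itself.\<close>

lemma tail_mixture_unbounded:
  assumes "martingale d" "\<And>\<sigma>. 0 < d \<sigma>" "succeeds_on d X"
  shows "\<exists>m. K \<le> tail_mixture d (initial (\<lambda>i. X (n + i)) m)"
proof -
  let ?Y = "\<lambda>i. X (n + i)" and ?\<rho> = "initial X n"
  obtain i where i: "string_code ?\<rho> = Suc i"
    using string_code_pos[of ?\<rho>] by (auto simp: gr0_conv_Suc)
  then have inv: "inv string_code (Suc i) = ?\<rho>"
    using inv_f_f[OF inj_string_code, of ?\<rho>] by simp
  let ?c = "d (?\<rho> @ initial ?Y (Suc i))"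
  obtain l where l: "n + Suc i \<le> l" "K * 2 ^ Suc i * ?c \<le> d (initial X l)"
    using succeeds_onD[OF assms(3)] by blast
  define m where "m = l - n"
  have m: "Suc i \<le> m" "initial X l = ?\<rho> @ initial ?Y m"
    using l(1) initial_add[of X n m] by (auto simp: m_def)
  let ?t = "\<lambda>j. (1 / 2) ^ Suc j * (d (inv string_code (Suc j) @ initial ?Y m)
    / d (inv string_code (Suc j) @ take (Suc j) (initial ?Y m)))"
  have "K \<le> ?t i"
    using l(2) assms(2)[of "?\<rho> @ initial ?Y (Suc i)"] m
    by (simp add: inv take_initial field_simps del: power_Suc)
  also have "?t i \<le> (\<Sum>j<m. ?t j)"
    using m(1) by (intro member_le_sum) (auto simp: martingale_nonneg[OF assms(1)])
  also have "\<dots> \<le> tail_mixture d (initial ?Y m)"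
    by (simp add: tail_mixture_def)
  finally show ?thesis by blast
qed

section \<open>Reducibility and covers of winning sets\<close>

lemma not_in_CR_I:
  assumes "martingale d" "exactly_computable Z d" "succeeds_on d X"
  shows "X \<notin> CR Z"
  using assms exactly_computable_imp_computable_real[of Z d] by (auto simp: CR_def)

lemma CR_le_if_winning_covers:
  assumes "\<And>V. winning_open A V \<Longrightarrow> \<exists>W. winning_open B W \<and> V \<subseteq> W"
  shows "CR_le A B"
  unfolding CR_le_def
proof
  fix X assume "X \<in> CR B"
  show "X \<in> CR A"
  proof (rule ccontr)
    assume "X \<notin> CR A"
    then obtain d where d: "martingale d" "computable_real A d" "succeeds_on d X"
      by (auto simp: CR_def)
    obtain d' where d': "martingale d'" "exactly_computable A d'" "\<And>\<sigma>. d \<sigma> + 1 \<le> d' \<sigma>"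
      using exactly_computable_dominating_martingale[OF d(1,2)] by blast
    have pos: "0 < d' \<sigma>" for \<sigma>
      using d'(3)[of \<sigma>] martingale_nonneg[OF d(1), of \<sigma>] by linarith
    have "succeeds_on d' X"
    proof (rule succeeds_onI)
      fix K
      obtain n where "K \<le> d (initial X n)" using succeeds_onD[OF d(3)] by blast
      then show "\<exists>n. K \<le> d' (initial X n)" using d'(3)[of "initial X n"] by (intro exI[of _ n]) linarith
    qed
    define V where "V = cylinder {\<sigma>. minimal_such (\<lambda>\<tau>. of_rat 2 \<le> tail_mixture d' \<tau>) \<sigma>}"
    have tails: "(\<lambda>i. X (n + i)) \<in> V" for n
    proof -
      obtain m where "of_rat 2 \<le> tail_mixture d' (initial (\<lambda>i. X (n + i)) m)"
        using tail_mixture_unbounded[OF d'(1) pos \<open>succeeds_on d' X\<close>] by blast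
      then obtain m' where "minimal_such (\<lambda>\<tau>. of_rat 2 \<le> tail_mixture d' \<tau>)
          (initial (\<lambda>i. X (n + i)) m')"
        by (rule minimal_such_initial)
      then show ?thesis by (auto simp: V_def cylinder_def)
    qed
    have "winning_open A V"
      unfolding winning_open_def
    proof (intro exI[of _ "tail_mixture d'"] exI[of _ 2] conjI)
      show "martingale (tail_mixture d')" by (rule martingale_tail_mixture[OF d'(1) pos])
      show "exactly_computable A (tail_mixture d')" by (rule exactly_computable_tail_mixture[OF d'(2)])
    show "normed (tail_mixture d')" by (simp add: normed_def tail_mixture_def)
    qed (simp_all add: V_def)
    then obtain e r where e: "martingale e" "normed e" "exactly_computable B e" "1 < r"
      and cover: "V \<subseteq> cylinder {\<sigma>. minimal_such (\<lambda>\<tau>. of_rat r \<le> e \<tau>) \<sigma>}"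
      using assms unfolding winning_open_def by metis
    have "succeeds_on (restart e (of_rat r)) X"
    proof (rule succeeds_on_restart[OF e(1,2), where P = UNIV])
      fix n
      have "(\<lambda>i. X (n + i)) \<in> cylinder {\<sigma>. minimal_such (\<lambda>\<tau>. of_rat r \<le> e \<tau>) \<sigma>}"
        using tails cover by blast
      then show "\<exists>m. n + m \<in> UNIV \<and> minimal_such (\<lambda>\<tau>. of_rat r \<le> e \<tau>) (initial (\<lambda>i. X (n + i)) m)"
        by (auto simp: cylinder_def)
    qed (use e(4) in simp_all)
    then have "X \<notin> CR B"
      by (rule not_in_CR_I[OF martingale_restart[OF e(1,2)] exactly_computable_restart[OF e(3)]])
    with \<open>X \<in> CR B\<close> show False by contradiction
  qed
qed

text \<open>The shift of \<open>m\<close> by \<open>\<rho>\<close>, normed, has a winning set for a threshold \<open>r\<close> with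
  \<open>1 < r < K / m \<rho>\<close>. Some \<open>X\<close> in the uncovered set escapes it, and the minimal string is taken
  along this \<open>X\<close>.\<close>

lemma uncovered_winning_string:
  assumes uncovered: "\<not> (\<exists>W. winning_open B W \<and> cylinder {\<sigma>. minimal_such P \<sigma>} \<subseteq> W)"
    and m: "martingale m" "exactly_computable B m" and "0 < m \<rho>" "m \<rho> < K"
  obtains \<sigma> where "minimal_such P \<sigma>" "\<And>\<tau>. prefix \<tau> \<sigma> \<Longrightarrow> m (\<rho> @ \<tau>) < K"
proof -
  obtain a where a: "m \<rho> = of_rat a"
    using m(2) unfolding exactly_computable_def by blast
  have "1 < K / m \<rho>" using assms(4,5) by simp
  then obtain r where r: "1 < real_of_rat r" "of_rat r < K / m \<rho>"
    using of_rat_dense by blast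
  let ?d = "\<lambda>\<sigma>. m (\<rho> @ \<sigma>) / m \<rho>"
  let ?W = "cylinder {\<sigma>. minimal_such (\<lambda>\<tau>. of_rat r \<le> ?d \<tau>) \<sigma>}"
  have "winning_open B ?W"
    unfolding winning_open_def
  proof (intro exI conjI)
    show "martingale ?d" by (rule martingale_normalized_shift[OF m(1)])
    show "exactly_computable B ?d"
      unfolding a by (intro computable exactly_computable_compose[OF m(2)])
    show "1 < r" using r(1) by simp
  qed (use assms(4) in \<open>simp_all add: normed_def\<close>)
  then obtain X where X: "X \<in> cylinder {\<sigma>. minimal_such P \<sigma>}" "X \<notin> ?W"
    using uncovered by blast
  then obtain n where n: "minimal_such P (initial X n)"
    by (auto simp: cylinder_def)
  have "m (\<rho> @ \<tau>) < K" if "prefix \<tau> (initial X n)" for \<tau>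
  proof -
    have "\<not> of_rat r \<le> ?d (initial X j)" for j
    proof
      assume "of_rat r \<le> ?d (initial X j)"
      then obtain l where "minimal_such (\<lambda>\<tau>. of_rat r \<le> ?d \<tau>) (initial X l)"
        by (rule minimal_such_initial)
      then show False using X(2) by (auto simp: cylinder_def)
    qed
    then have "?d \<tau> < of_rat r"
      using prefix_initialD[OF that] by (metis not_le)
    then have "?d \<tau> < K / m \<rho>" using r(2) by linarith
    then show ?thesis using assms(4) by (simp add: divide_less_cancel)
  qed
  then show ?thesis using n that by blast
qed

lemma winning_covers_if_CR_le:
  assumes "CR_le A B" "winning_open A V"
  shows "\<exists>W. winning_open B W \<and> V \<subseteq> W"
proof (rule ccontr)
  assume uncovered: "\<not> ?thesis"
  obtain d q where d: "martingale d" "normed d" "exactly_computable A d" "1 < q"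
    and V: "V = cylinder {\<sigma>. minimal_such (\<lambda>\<tau>. of_rat q \<le> d \<tau>) \<sigma>}"
    using assms(2) unfolding winning_open_def by metis
  define win where "win = minimal_such (\<lambda>\<tau>. of_rat q \<le> d \<tau>)"
  have win_Nil: "\<not> win []"
    using d(2,4) by (simp add: win_def minimal_such_def normed_def)
  have const: "martingale (\<lambda>\<sigma>. 1)" "exactly_computable B (\<lambda>\<sigma>. 1)"
    using exactly_computable_const[of B 1] by (simp_all add: martingale_def)

  let ?M = "{e. martingale e \<and> exactly_computable B e}"
  have "countable ?M" "?M \<noteq> {}"
    using countable_subset[OF _ countable_exactly_computable, of ?M B] const by auto
  then have range: "range (from_nat_into ?M) = ?M"
    by (intro range_from_nat_into)
  define e where "e = from_nat_into ?M"
  have e: "martingale (e k)" "exactly_computable B (e k)" for k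
    using range unfolding e_def by blast+

  (* A state consists of the string built so far and the combination of the martingales treated
     so far. The constant 1 in that combination keeps it positive, as is needed for norming. *)
  define good where "good = (\<lambda>(k :: nat) (\<rho> :: bool list, m). (k = 0 \<longrightarrow> \<rho> = []) \<and>
    martingale m \<and> exactly_computable B m \<and> (\<forall>\<sigma>. 1 \<le> m \<sigma>) \<and> m \<rho> < (2 :: real))"
  define ext where "ext = (\<lambda>k (\<rho>, m) (\<rho>', m'). \<exists>\<sigma> a. \<rho>' = \<rho> @ \<sigma> \<and> win \<sigma> \<and>
    0 < a \<and> m' = (\<lambda>\<tau>. m \<tau> + of_rat a * e k \<tau>) \<and> (\<forall>\<tau>. prefix \<tau> \<sigma> \<longrightarrow> m' (\<rho> @ \<tau>) < 2))"
  have "\<exists>s. good 0 s"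
    using const by (intro exI[of _ "([], \<lambda>\<sigma>. 1)"]) (simp add: good_def)
  moreover have "\<exists>s'. good (Suc k) s' \<and> ext k s s'" if "good k s" for k s
  proof -
    obtain \<rho> m where s: "s = (\<rho>, m)" by force
    then have m: "martingale m" "exactly_computable B m" "\<And>\<sigma>. 1 \<le> m \<sigma>" "m \<rho> < 2"
      using that by (auto simp: good_def)
    (* the multiple of e k has to use up less than the distance of m from 2 at \<rho> *)
    define c where "c = e k \<rho> + 1"
    have c: "0 < c" "e k \<rho> < c"
      using martingale_nonneg[OF e(1), of k \<rho>] by (simp_all add: c_def)
    then obtain a where a: "0 < real_of_rat a" "of_rat a < (2 - m \<rho>) / c"
      using of_rat_dense[of 0 "(2 - m \<rho>) / c"] m(4) by auto
    define m' where "m' = (\<lambda>\<tau>. m \<tau> + of_rat a * e k \<tau>)"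
    have m': "martingale m'" "exactly_computable B m'"
      unfolding m'_def using a(1) m e
      by (auto intro!: martingale_add_mult computable)
    have m'1: "1 \<le> m' \<sigma>" for \<sigma>
      using m(3)[of \<sigma>] a(1) martingale_nonneg[OF e(1), of k \<sigma>] by (simp add: m'_def add_increasing2)
    have "of_rat a * e k \<rho> < 2 - m \<rho>"
    proof -
      have "of_rat a * e k \<rho> \<le> of_rat a * c" using a(1) c(2) by (intro mult_left_mono) auto
      also have "\<dots> < 2 - m \<rho>" using a(2) c(1) by (simp add: pos_less_divide_eq)
      finally show ?thesis .
    qed
    then have "m' \<rho> < 2" by (simp add: m'_def)
    moreover have "0 < m' \<rho>" using m'1[of \<rho>] by linarith
    ultimately obtain \<sigma> where \<sigma>: "win \<sigma>" "\<And>\<tau>. prefix \<tau> \<sigma> \<Longrightarrow> m' (\<rho> @ \<tau>) < 2"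
      using uncovered_winning_string[OF uncovered[unfolded V] m'] unfolding win_def by metis
    have "good (Suc k) (\<rho> @ \<sigma>, m')"
      using m' m'1 \<sigma>(2)[of \<sigma>] by (simp add: good_def)
    moreover have "ext k s (\<rho> @ \<sigma>, m')"
      using \<sigma> a(1) by (auto simp: ext_def s m'_def)
    ultimately show ?thesis by blast
  qed
  ultimately obtain s where s: "\<And>k. good k (s k)" "\<And>k. ext k (s k) (s (Suc k))"
    using dependent_nat_choice[of good ext] by blast
  define \<rho> where "\<rho> = (\<lambda>k. fst (s k))"
  define m where "m = (\<lambda>k. snd (s k))"
  define link where "link = (\<lambda>k \<sigma> a. \<rho> (Suc k) = \<rho> k @ \<sigma> \<and> win \<sigma> \<and> 0 < a \<and>
    m (Suc k) = (\<lambda>\<tau>. m k \<tau> + of_rat a * e k \<tau>) \<and>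
    (\<forall>\<tau>. prefix \<tau> \<sigma> \<longrightarrow> m (Suc k) (\<rho> k @ \<tau>) < 2))"
  have "\<exists>\<sigma> a. link k \<sigma> a" for k
    using s(2)[of k] unfolding link_def ext_def \<rho>_def m_def by (simp add: case_prod_unfold)
  then obtain \<sigma> a where "\<And>k. link k (\<sigma> k) (a k)"
    by metis
  then have \<rho>_Suc: "\<rho> (Suc k) = \<rho> k @ \<sigma> k" and win: "win (\<sigma> k)" and a: "0 < a k"
    and m_Suc: "m (Suc k) = (\<lambda>\<tau>. m k \<tau> + of_rat (a k) * e k \<tau>)"
    and below2: "prefix \<tau> (\<sigma> k) \<Longrightarrow> m (Suc k) (\<rho> k @ \<tau>) < 2" for k \<tau>
    unfolding link_def by blast+
  have m1: "1 \<le> m k \<tau>" for k \<tau>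
    using s(1)[of k] by (auto simp: good_def m_def case_prod_unfold)

  have \<rho>_prefix: "prefix (\<rho> k) (\<rho> l)" if "k \<le> l" for k l
    using that by (induction l rule: dec_induct) (auto simp: \<rho>_Suc intro: prefix_order.trans)
  have len_step: "length (\<rho> k) < length (\<rho> (Suc k))" for k
    using win[of k] win_Nil by (auto simp: \<rho>_Suc)
  have len: "k \<le> length (\<rho> k)" for k
  proof (induction k)
    case (Suc k)
    then show ?case using len_step[of k] by linarith
  qed simp
  define X where "X = (\<lambda>i. \<rho> (Suc i) ! i)"
  have X: "initial X (length (\<rho> k)) = \<rho> k" for k
  proof (rule nth_equalityI)
    fix i assume "i < length (initial X (length (\<rho> k)))"
    then have "i < length (\<rho> k)" "i < length (\<rho> (Suc i))"
      using len[of "Suc i"] by simp_all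
    then have "\<rho> (Suc i) ! i = \<rho> k ! i"
      using \<rho>_prefix[of "Suc i" k] \<rho>_prefix[of k "Suc i"] linear[of k "Suc i"]
      by (auto simp: prefix_def nth_append)
    then show "initial X (length (\<rho> k)) ! i = \<rho> k ! i"
      using \<open>i < length (\<rho> k)\<close> by (simp add: initial_def X_def)
  qed simp

  have "succeeds_on (restart d (of_rat q)) X"
  proof (rule succeeds_on_restart[OF d(1,2), where P = "range (\<lambda>k. length (\<rho> k))"])
    have "\<rho> 0 = []"
      using s(1)[of 0] by (simp add: good_def \<rho>_def case_prod_unfold)
    then show "0 \<in> range (\<lambda>k. length (\<rho> k))" by (metis list.size(3) rangeI)
    fix n assume "n \<in> range (\<lambda>k. length (\<rho> k))"
    then obtain k where k: "n = length (\<rho> k)" by blast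
    have "\<rho> k @ initial (\<lambda>i. X (n + i)) (length (\<sigma> k)) = \<rho> k @ \<sigma> k"
      using initial_add[of X n "length (\<sigma> k)"] X[of k] X[of "Suc k"] by (simp add: k \<rho>_Suc)
    then have "win (initial (\<lambda>i. X (n + i)) (length (\<sigma> k)))" using win[of k] by simp
    moreover have "n + length (\<sigma> k) = length (\<rho> (Suc k))" by (simp add: k \<rho>_Suc)
    ultimately show "\<exists>m. n + m \<in> range (\<lambda>k. length (\<rho> k)) \<and>
        minimal_such (\<lambda>\<tau>. of_rat q \<le> d \<tau>) (initial (\<lambda>i. X (n + i)) m)"
      unfolding win_def by blast
  qed (use d(4) in simp)
  then have "X \<notin> CR A"
    by (rule not_in_CR_I[OF martingale_restart[OF d(1,2)] exactly_computable_restart[OF d(3)]])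
  moreover have "X \<in> CR B"
    unfolding CR_def mem_Collect_eq
  proof
    assume "\<exists>d. martingale d \<and> computable_real B d \<and> succeeds_on d X"
    then obtain d where d: "martingale d" "computable_real B d" "succeeds_on d X"
      by blast
    obtain d' where d': "martingale d'" "exactly_computable B d'" "\<And>\<sigma>. d \<sigma> + 1 \<le> d' \<sigma>"
      using exactly_computable_dominating_martingale[OF d(1,2)] by blast
    then obtain k where k: "d' = e k"
      using range unfolding e_def by blast
    obtain n where n: "length (\<rho> k) \<le> n" "2 / of_rat (a k) \<le> d (initial X n)"
      using succeeds_onD[OF d(3)] by blast
    (* initial X n ends in the l-th block of X *)
    define l where "l = (LEAST l. n < length (\<rho> (Suc l)))"
    have "n < length (\<rho> (Suc n))"
      using len[of "Suc n"] by simp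
    then have l: "n < length (\<rho> (Suc l))"
      unfolding l_def by (rule LeastI)
    have "length (\<rho> l) \<le> n"
    proof (cases l)
      case 0
      have "length (\<rho> 0) \<le> length (\<rho> k)" by (intro prefix_length_le \<rho>_prefix) simp
      then show ?thesis using n(1) 0 by simp
    next
      case (Suc l')
      then show ?thesis using not_less_Least[of l' "\<lambda>l. n < length (\<rho> (Suc l))"] l_def by simp
    qed
    have "k \<le> l"
    proof (rule ccontr)
      assume "\<not> k \<le> l"
      then have "length (\<rho> (Suc l)) \<le> length (\<rho> k)" by (intro prefix_length_le \<rho>_prefix) simp
      then show False using l n(1) by simp
    qed
    have "initial X n = take n (\<rho> (Suc l))"
      using take_initial[of n "length (\<rho> (Suc l))" X] l by (simp add: X)
    then have "initial X n = \<rho> l @ take (n - length (\<rho> l)) (\<sigma> l)"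
      using \<open>length (\<rho> l) \<le> n\<close> by (simp add: \<rho>_Suc)
    then have "m (Suc l) (initial X n) < 2"
      by (simp add: below2 take_is_prefix)
    moreover have "m (Suc k) \<tau> \<le> m (Suc l) \<tau>" for \<tau>
      using \<open>k \<le> l\<close>
    proof (induction l rule: dec_induct)
      case (step l)
      then show ?case
        using a[of "Suc l"] martingale_nonneg[OF e(1), of "Suc l" \<tau>] m_Suc[of "Suc l"]
        by (simp add: add_increasing2)
    qed simp
    ultimately have "m (Suc k) (initial X n) < 2"
      by (meson le_less_trans)
    then have "of_rat (a k) * e k (initial X n) < 2"
      using m1[of k "initial X n"] by (simp add: m_Suc)
    moreover have "2 / of_rat (a k) \<le> e k (initial X n)"
      using n(2) d'(3)[of "initial X n"] by (simp add: k)
    ultimately show False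
      using a[of k] by (simp add: field_simps)
  qed
  ultimately show False using assms(1) by (auto simp: CR_le_def)
qed

theorem corollary4p2:
  fixes A B :: "nat \<Rightarrow> bool"
  shows "CR_le A B \<longleftrightarrow>
    (\<forall>V. winning_open A V \<longrightarrow> (\<exists>W. winning_open B W \<and> V \<subseteq> W))"
  using winning_covers_if_CR_le CR_le_if_winning_covers by blast

end
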